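(* Let $f=h+\overline{g}$ be a harmonic mapping of the open unit disk $\mathbb{D}$ whose dilatation $\omega=g'/h'=q^2$ is the square of a meromorphic function $q$ in $\mathbb{D}$. If either, for some $t\geq 1$, $$\left|\mathcal{S} f-\frac{2t(1-t)\bar{z}^2}{(1-|z|^2)^2}\right|+e^{2\sigma}|K|\leq \frac{2t}{(1-|z|^2)^2}\qquad\text{for all } z\in\mathbb{D},$$ or, for some $0\leq t<1$, $$\left|\mathcal{S} f-\frac{2t(1-t)\bar{z}^2}{(1-|z|^2)^2}\right|+e^{2\sigma}|K|\leq \frac{2t}{(1-|z|^2)^2}+\frac{2\pi}{(1-|z|^2)^{2t}}\left(\frac{\Gamma (\frac{3}{2}-t)}{\Gamma (1-t)}\right)^2\qquad\text{for all } z\in\mathbb{D},$$ then the lift $\widetilde{f}$ is injective in $\mathbb{D}$.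
   Context: $\mathbb{D}=\{|z|<1\}$; $\Gamma$ is the Gamma function; subscripts $z,\bar z$ denote the Wirtinger derivatives, $\partial_z=\frac12(\partial_x-i\partial_y)$. A harmonic mapping of $\mathbb{D}$ is a complex-valued harmonic function written $f=h+\overline{g}$ with $h,g$ analytic in $\mathbb{D}$; it is assumed that $|h'|+|g'|\neq 0$ in $\mathbb{D}$, but $f$ is not required to be locally univalent. If its dilatation is $\omega=g'/h'=q^2$ with $q$ meromorphic, its Weierstrass--Enneper lift is the conformal immersion $\widetilde f=(U,V,W):\mathbb{D}\to\mathbb{R}^3$ onto a minimal surface $\Sigma=\widetilde f(\mathbb{D})$ given by $U=\mathrm{Re}\,f$, $V=\mathrm{Im}\,f$, $W(z)=2\,\mathrm{Im}\int_{z_0}^z h'(\zeta)q(\zeta)\,d\zeta$, for a fixed base point $z_0\in\mathbb{D}$. The first fundamental form of the surface is $e^{2\sigma}|dz|^2$ with $e^\sigma=|h'|+|g'|$; $K=-e^{-2\sigma}\Delta\sigma\le 0$ is the Gauss curvature of the surface at $\widetilde f(z)$. The Schwarzian derivative of $f$ is $\mathcal{S}f=2(\sigma_{zz}-\sigma_z^2)$. *)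

theory Defs
  imports "HOL-Complex_Analysis.Complex_Analysis"
begin

definition harmonic_mapping :: "(complex \<Rightarrow> complex) \<Rightarrow> (complex \<Rightarrow> complex) \<Rightarrow> (complex \<Rightarrow> complex) \<Rightarrow> bool"
  where "harmonic_mapping f h g \<longleftrightarrow>
    h analytic_on ball 0 1 \<and> g analytic_on ball 0 1 \<and>
    (\<forall>z\<in>ball 0 1. f z = h z + cnj (g z)) \<and>
    (\<forall>z\<in>ball 0 1. norm (deriv h z) + norm (deriv g z) \<noteq> 0)"

text \<open>
  Identity of meromorphic functions in the disk: it is required off a discrete set only, since
  \<open>q\<close> carries arbitrary values at its singularities and \<open>deriv g z / deriv h z\<close>
  takes the junk value 0 at the zeros of \<open>deriv h\<close>. Nonvanishing of \<open>deriv h\<close> off a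
  discrete set says that \<open>deriv h\<close> is not identically zero, so that the quotient is meromorphic.
\<close>

definition dilatation_is_square_of :: "(complex \<Rightarrow> complex) \<Rightarrow> (complex \<Rightarrow> complex) \<Rightarrow> (complex \<Rightarrow> complex) \<Rightarrow> bool"
  where "dilatation_is_square_of h g q \<longleftrightarrow>
    q meromorphic_on ball 0 1 \<and>
    (\<forall>\<^sub>\<approx>z\<in>ball 0 1. deriv h z \<noteq> 0 \<and> deriv g z / deriv h z = (q z)\<^sup>2)"

text \<open>
  The integrand extends holomorphically to the disk: at a pole of \<open>q\<close> of order \<open>n\<close>
  the function \<open>deriv h\<close> has a zero of order \<open>2 * n\<close>. The integral is therefore
  path independent, and finitely many exceptional values on the segment do not affect it.
\<close>

definition weierstrass_enneper_lift ::
  "(complex \<Rightarrow> complex) \<Rightarrow> (complex \<Rightarrow> complex) \<Rightarrow> (complex \<Rightarrow> complex) \<Rightarrow> complex \<Rightarrow> complex \<Rightarrow> real ^ 3"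
  where "weierstrass_enneper_lift f h q z0 z =
    vector [Re (f z), Im (f z), 2 * Im (contour_integral (linepath z0 z) (\<lambda>\<zeta>. deriv h \<zeta> * q \<zeta>))]"

definition partial_x :: "(complex \<Rightarrow> 'a::real_normed_vector) \<Rightarrow> complex \<Rightarrow> 'a"
  where "partial_x F z = vector_derivative (\<lambda>s::real. F (z + of_real s)) (at 0)"

definition partial_y :: "(complex \<Rightarrow> 'a::real_normed_vector) \<Rightarrow> complex \<Rightarrow> 'a"
  where "partial_y F z = vector_derivative (\<lambda>s::real. F (z + \<i> * of_real s)) (at 0)"

definition wirtinger_z :: "(complex \<Rightarrow> complex) \<Rightarrow> complex \<Rightarrow> complex"
  where "wirtinger_z F z = (partial_x F z - \<i> * partial_y F z) / 2"

definition laplacian :: "(complex \<Rightarrow> real) \<Rightarrow> complex \<Rightarrow> real"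
  where "laplacian F z = partial_x (partial_x F) z + partial_y (partial_y F) z"

text \<open>The logarithm \<open>\<sigma>\<close> of the conformal factor, \<open>exp \<sigma> = norm h' + norm g'\<close>.\<close>

definition conformal_log :: "(complex \<Rightarrow> complex) \<Rightarrow> (complex \<Rightarrow> complex) \<Rightarrow> complex \<Rightarrow> real"
  where "conformal_log h g z = ln (norm (deriv h z) + norm (deriv g z))"

definition gauss_curvature :: "(complex \<Rightarrow> complex) \<Rightarrow> (complex \<Rightarrow> complex) \<Rightarrow> complex \<Rightarrow> real"
  where "gauss_curvature h g z =
    - exp (- 2 * conformal_log h g z) * laplacian (conformal_log h g) z"

definition schwarzian :: "(complex \<Rightarrow> complex) \<Rightarrow> (complex \<Rightarrow> complex) \<Rightarrow> complex \<Rightarrow> complex"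
  where "schwarzian h g z =
    (let \<sigma> = (\<lambda>w. complex_of_real (conformal_log h g w))
     in 2 * (wirtinger_z (wirtinger_z \<sigma>) z - (wirtinger_z \<sigma> z)\<^sup>2))"

end

theory Submission
  imports Defs
begin

text \<open>
Write \<open>F\<close> for the lift and \<open>exp \<sigma>\<close> for its conformal factor, and equip the disk with the metric
\<open>exp (2 * \<phi>) |dz|\<^sup>2\<close>, where \<open>\<phi> = - t ln (1 - |z|\<^sup>2)\<close>. Suppose that \<open>F\<close> takes the same value \<open>P\<close> at two
points. Join these points by a geodesic of the metric and follow
\<open>v = |F - P| exp ((\<phi> - \<sigma>) / 2)\<close> along it. Compose the lift with an inversion that sends \<open>P\<close> to infinity and divide
its conformal factor by \<open>exp \<phi>\<close>: then \<open>v\<close> is the inverse square root of this ratio, which is why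
its second derivative is governed by a Schwarzian. In the arc length \<open>s\<close> of the metric one finds
\<open>v'' / v \<ge> exp (- 2 * \<phi>) * (\<phi>_zz' - (|S f - S \<phi>| + exp (2 * \<sigma>) |K|) / 2)\<close>,
where \<open>\<phi>_zz'\<close> denotes the mixed derivative \<open>t / (1 - |z|\<^sup>2)\<^sup>2\<close> of \<open>\<phi>\<close> and
\<open>S \<phi> = 2 (\<phi>_zz - \<phi>_z\<^sup>2) = 2 t (1 - t) cnj z\<^sup>2 / (1 - |z|\<^sup>2)\<^sup>2\<close>. The hypothesis therefore says
\<open>v'' \<ge> - \<kappa>\<^sup>2 v\<close>, with \<open>\<kappa> = 0\<close> for \<open>t \<ge> 1\<close> and \<open>\<kappa> = \<pi> / \<delta>\<close> for \<open>t < 1\<close>, where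
\<open>\<delta> = sqrt \<pi> \<Gamma>(1 - t) / \<Gamma>(3/2 - t)\<close> is the length of a diameter of the disk. By Sturm comparison two zeros
of \<open>v\<close> have distance at least \<open>\<pi> / \<kappa>\<close>, but the geodesic is shorter than \<open>\<delta>\<close>: a contradiction.

Two ingredients make the argument elementary. First, the differential inequality is an algebraic one:
with \<open>k\<^sup>2 = h' g'\<close>, the vector \<open>(h' + g', - \<i> (h' - g'), - 2 \<i> k)\<close> is a
holomorphic null vector, and the only fact of surface theory that enters is the pointwise identity
\<open>normal_component_of_null_vector\<close>. It computes the second fundamental form in the direction of the chord
\<open>F - P\<close> and relates it to \<open>\<Delta> \<sigma> = exp (2 * \<sigma>) |K|\<close>; the inequality is
\<open>second_derivative_estimate\<close> and its analytic form \<open>log_distance_along_curve\<close>. Second, the metric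
is rotationally symmetric, so that its geodesics can be written down by Clairaut's relation
(\<open>geodesic_arc_of_clairaut\<close>), and a geodesic through two given points is found by the intermediate value
theorem (\<open>shooting_angle\<close>, \<open>geodesic_arc_exists\<close>). Their length is estimated in
\<open>geodesic_arc_length\<close>, and the comparison argument is \<open>riccati_comparison\<close>.
\<close>

section \<open>Wirtinger derivatives\<close>

lemma partial_derivatives_of_has_derivative:
  assumes "(F has_derivative D) (at z)"
  shows "partial_x F z = D 1" and "partial_y F z = D \<i>"
proof -
  have *: "vector_derivative (\<lambda>s::real. F (z + of_real s * c)) (at 0) = D c" for c
  proof (rule vector_derivative_at)
    interpret D: bounded_linear D using assms by (rule has_derivative_bounded_linear)
    have "((\<lambda>s::real. z + of_real s * c) has_derivative (\<lambda>s. of_real s * c)) (at 0)"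
      by (auto intro!: derivative_eq_intros)
    then have "((\<lambda>s::real. F (z + of_real s * c)) has_derivative (\<lambda>s. D (of_real s * c))) (at 0)"
      using has_derivative_compose[of "\<lambda>s::real. z + of_real s * c" _ 0 UNIV F D] assms by simp
    moreover have "D (of_real s * c) = s *\<^sub>R D c" for s :: real
      by (metis D.scaleR scaleR_conv_of_real)
    ultimately show "((\<lambda>s::real. F (z + of_real s * c)) has_vector_derivative D c) (at 0)"
      by (simp add: has_vector_derivative_def)
  qed
  show "partial_x F z = D 1" using *[of 1] by (simp add: partial_x_def)
  show "partial_y F z = D \<i>" using *[of \<i>] by (simp add: partial_y_def mult.commute)
qed

lemma wirtinger_z_of_has_derivative:
  assumes "(F has_derivative (\<lambda>w. a * w + b * cnj w)) (at z)"
  shows "wirtinger_z F z = a"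
  by (simp add: wirtinger_z_def partial_derivatives_of_has_derivative[OF assms] algebra_simps)

section \<open>Null vectors and their spinors\<close>

text \<open>
The quadric \<open>k\<^sup>2 = h g\<close> is the image of \<open>(p, q) \<mapsto> (p\<^sup>2, q\<^sup>2, p q)\<close>, and this map is a submersion onto it
away from the origin. Hence a point of the quadric together with a tangent vector \<open>(h2, g2, k2)\<close> lifts to
a pair \<open>(p, q)\<close> with a tangent vector \<open>(p1, q1)\<close>. All identities below become polynomial in the lift.
\<close>
lemma spinor_of_null_vector:
  fixes h1 g1 k1 h2 g2 k2 :: complex
  assumes null: "k1\<^sup>2 = h1 * g1" and null': "2 * k1 * k2 = h2 * g1 + h1 * g2"
    and nz: "norm h1 + norm g1 \<noteq> 0"
  obtains p q p1 q1 where "h1 = p\<^sup>2" "g1 = q\<^sup>2" "k1 = p * q"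
    "h2 = 2 * p * p1" "g2 = 2 * q * q1" "k2 = p * q1 + q * p1" "(cmod p)\<^sup>2 + (cmod q)\<^sup>2 > 0"
proof (cases "h1 = 0")
  case False
  define p q p1 q1 where "p = csqrt h1" and "q = k1 / p" and "p1 = h2 / (2 * p)" and "q1 = (k2 - q * p1) / p"
  have p: "p \<noteq> 0" "p\<^sup>2 = h1" using False by (auto simp: p_def)
  have k: "k1 = p * q" using p by (simp add: q_def)
  have g: "g1 = q\<^sup>2"
    using null False p by (auto simp: k power_mult_distrib)
  have h2: "h2 = 2 * p * p1" using p by (simp add: p1_def)
  have k2: "k2 = p * q1 + q * p1" using p by (simp add: q1_def)
  have "p\<^sup>2 * g2 = p\<^sup>2 * (2 * q * q1)"
    using null' unfolding k g h2 k2 p(2)[symmetric] by algebra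
  then have "g2 = 2 * q * q1" using p by (metis mult_left_cancel power_not_zero)
  then show ?thesis using that[of p q p1 q1] p g k h2 k2 by (simp add: add_pos_nonneg)
next
  case True
  define q p q1 p1 where "q = csqrt g1" and "p = k1 / q" and "q1 = g2 / (2 * q)" and "p1 = (k2 - p * q1) / q"
  have q: "q \<noteq> 0" "q\<^sup>2 = g1" using True nz by (auto simp: q_def)
  have k: "k1 = p * q" using q by (simp add: p_def)
  have h: "h1 = p\<^sup>2"
    using null nz True q by (auto simp: k power_mult_distrib)
  have g2: "g2 = 2 * q * q1" using q by (simp add: q1_def)
  have k2: "k2 = p * q1 + q * p1" using q by (simp add: p1_def)
  have "q\<^sup>2 * h2 = q\<^sup>2 * (2 * p * p1)"
    using null' unfolding k h g2 k2 q(2)[symmetric] by algebra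
  then have "h2 = 2 * p * p1" using q by (metis mult_left_cancel power_not_zero)
  then show ?thesis using that[of p q p1 q1] q h k g2 k2 by (simp add: add_nonneg_pos)
qed

lemma of_real_norm_square: "(complex_of_real (norm z))\<^sup>2 = z * cnj z"
  using complex_norm_square[of z] by simp

text \<open>
Here \<open>(h1, g1, k1)\<close> encodes the null vector \<open>\<Phi> = (h1 + g1, - \<i> (h1 - g1), - 2 \<i> k1)\<close>, \<open>(h2, g2, k2)\<close> its
derivative \<open>\<Phi>'\<close>, and \<open>(c, W)\<close> a vector \<open>X\<close> of Euclidean 3-space whose first two coordinates form the complex
number \<open>c\<close>. Then \<open>\<alpha> = \<Phi> \<bullet> X\<close>, \<open>\<gamma> = \<Phi>' \<bullet> X\<close>, and \<open>E\<close> is half the square norm of \<open>\<Phi>\<close>. The real and imaginary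
parts of \<open>\<Phi>\<close> are orthogonal of length \<open>sqrt E\<close>, so that \<open>|X|\<^sup>2 - |\<alpha>|\<^sup>2 / E\<close> is the square of the component of \<open>X\<close>
normal to both of them. The vector \<open>\<Phi>' - (Ez / E) \<Phi>\<close> has square norm \<open>2 (E Ezz - |Ez|\<^sup>2) / E\<close> and is a complex
multiple of the unit normal; this yields the third claim. In spinors the normal component of \<open>X\<close> is
\<open>m / B\<close>, and the multiple is \<open>2 \<i> \<delta>\<close>.
\<close>
lemma normal_component_of_null_vector:
  fixes h1 g1 k1 h2 g2 k2 c :: complex and W :: real
  assumes null: "k1\<^sup>2 = h1 * g1" and null': "2 * k1 * k2 = h2 * g1 + h1 * g2"
    and nz: "norm h1 + norm g1 \<noteq> 0"
  defines "E \<equiv> (norm h1)\<^sup>2 + (norm g1)\<^sup>2 + 2 * (norm k1)\<^sup>2"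
    and "Ez \<equiv> h2 * cnj h1 + g2 * cnj g1 + 2 * k2 * cnj k1"
    and "Ezz \<equiv> (norm h2)\<^sup>2 + (norm g2)\<^sup>2 + 2 * (norm k2)\<^sup>2"
    and "\<alpha> \<equiv> h1 * cnj c + g1 * c - 2 * \<i> * k1 * of_real W"
    and "\<gamma> \<equiv> h2 * cnj c + g2 * c - 2 * \<i> * k2 * of_real W"
  shows "E > 0"
    and "E * Ezz - (norm Ez)\<^sup>2 \<ge> 0"
    and "(norm (\<gamma> - Ez / of_real E * \<alpha>))\<^sup>2
           = 2 * (E * Ezz - (norm Ez)\<^sup>2) / E\<^sup>2 * (E * ((norm c)\<^sup>2 + W\<^sup>2) - (norm \<alpha>)\<^sup>2)"
    and "E * ((norm c)\<^sup>2 + W\<^sup>2) - (norm \<alpha>)\<^sup>2 \<ge> 0"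
proof -
  obtain p q p1 q1 where s: "h1 = p\<^sup>2" "g1 = q\<^sup>2" "k1 = p * q"
    "h2 = 2 * p * p1" "g2 = 2 * q * q1" "k2 = p * q1 + q * p1" and pos: "(cmod p)\<^sup>2 + (cmod q)\<^sup>2 > 0"
    using spinor_of_null_vector[OF null null' nz] by metis
  define B where "B = (norm p)\<^sup>2 + (norm q)\<^sup>2"
  define \<delta> where "\<delta> = p * q1 - q * p1"
  define m where "m = 2 * Im (cnj p * q * c) - ((norm p)\<^sup>2 - (norm q)\<^sup>2) * W"
  have B0: "B > 0" using pos by (simp add: B_def)
  have Bc: "complex_of_real B = p * cnj p + q * cnj q"
    by (simp add: B_def of_real_norm_square)
  have mc: "complex_of_real m = - \<i> * (cnj p * q * c - p * cnj q * cnj c)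
      - (p * cnj p - q * cnj q) * of_real W"
    by (simp add: m_def of_real_norm_square[symmetric] complex_eq_iff algebra_simps)
  have E: "E = B\<^sup>2"
    by (simp add: E_def s B_def norm_mult norm_power power2_eq_square algebra_simps)
  have Ez: "Ez = 2 * (p1 * cnj p + q1 * cnj q) * of_real B"
    by (simp add: Ez_def s Bc power2_eq_square algebra_simps)
  have DE: "E * Ezz - (norm Ez)\<^sup>2 = 2 * (norm \<delta>)\<^sup>2 * B\<^sup>2"
  proof -
    have "complex_of_real (E * Ezz - (norm Ez)\<^sup>2) = of_real (2 * (norm \<delta>)\<^sup>2 * B\<^sup>2)"
      unfolding E Ez Ezz_def s \<delta>_def
      by (simp add: of_real_norm_square norm_mult power_mult_distrib Bc[symmetric] del: of_real_power of_real_mult of_real_add)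
         (simp add: of_real_norm_square Bc, algebra)
    then show ?thesis by (simp only: of_real_eq_iff)
  qed
  have mu: "of_real B * (\<gamma> - Ez / of_real E * \<alpha>) = 2 * \<i> * \<delta> * of_real m"
  proof -
    have "of_real B * (\<gamma> - Ez / of_real E * \<alpha>) = of_real B * \<gamma> - 2 * (p1 * cnj p + q1 * cnj q) * \<alpha>"
      using B0 by (simp add: E Ez power2_eq_square field_simps)
    also have "\<dots> = 2 * \<i> * \<delta> * of_real m"
      unfolding \<gamma>_def \<alpha>_def Bc mc s \<delta>_def
      by (simp add: power2_eq_square algebra_simps)
    finally show ?thesis .
  qed
  have N: "E * ((norm c)\<^sup>2 + W\<^sup>2) - (norm \<alpha>)\<^sup>2 = m\<^sup>2"
  proof -
    have "complex_of_real (E * ((norm c)\<^sup>2 + W\<^sup>2) - (norm \<alpha>)\<^sup>2) = of_real (m\<^sup>2)"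
      unfolding E \<alpha>_def s
      by (simp add: of_real_norm_square Bc mc) (simp add: power2_eq_square algebra_simps)
    then show ?thesis by (simp only: of_real_eq_iff)
  qed
  show "E > 0" using B0 by (simp add: E)
  show "E * Ezz - (norm Ez)\<^sup>2 \<ge> 0" by (simp add: DE)
  show "E * ((norm c)\<^sup>2 + W\<^sup>2) - (norm \<alpha>)\<^sup>2 \<ge> 0" by (simp add: N)
  have "B\<^sup>2 * (norm (\<gamma> - Ez / of_real E * \<alpha>))\<^sup>2 = (norm (of_real B * (\<gamma> - Ez / of_real E * \<alpha>)))\<^sup>2"
    by (simp add: norm_mult power_mult_distrib)
  also have "\<dots> = 4 * (norm \<delta>)\<^sup>2 * m\<^sup>2"
    unfolding mu by (simp add: norm_mult power_mult_distrib)
  finally have "(norm (\<gamma> - Ez / of_real E * \<alpha>))\<^sup>2 = 4 * (norm \<delta>)\<^sup>2 * m\<^sup>2 / B\<^sup>2"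
    using B0 by (simp add: field_simps)
  then show "(norm (\<gamma> - Ez / of_real E * \<alpha>))\<^sup>2
           = 2 * (E * Ezz - (norm Ez)\<^sup>2) / E\<^sup>2 * (E * ((norm c)\<^sup>2 + W\<^sup>2) - (norm \<alpha>)\<^sup>2)"
    unfolding DE N using B0 by (simp add: E power2_eq_square)
qed

section \<open>Conformal factor, curvature and Schwarzian of the lift\<close>

lemma has_derivative_cnj_compose:
  "(f has_derivative f') F \<Longrightarrow> ((\<lambda>x. cnj (f x)) has_derivative (\<lambda>x. cnj (f' x))) F"
  by (rule bounded_linear.has_derivative[OF bounded_linear_cnj])

text \<open>
The Weierstrass-Enneper representation without the meromorphic function \<open>q\<close>: the lift is
\<open>(Re (h + g), Im (h - g), 2 Im K)\<close>, where \<open>K' = h' q\<close> is characterised by \<open>K'\<^sup>2 = h' g'\<close>.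
\<close>
locale weierstrass_data =
  fixes h g K :: "complex \<Rightarrow> complex"
  assumes hol_h: "h holomorphic_on ball 0 1" and hol_g: "g holomorphic_on ball 0 1"
    and hol_K: "K holomorphic_on ball 0 1"
    and null: "z \<in> ball 0 1 \<Longrightarrow> (deriv K z)\<^sup>2 = deriv h z * deriv g z"
    and immersed: "z \<in> ball 0 1 \<Longrightarrow> norm (deriv h z) + norm (deriv g z) \<noteq> 0"
begin

text \<open>
\<open>E = exp (2 * \<sigma>) = (|h'| + |g'|)\<^sup>2\<close>. The term \<open>|K'|\<^sup>2\<close> stands for \<open>|h'| |g'|\<close>; in this form \<open>E\<close> is visibly smooth at
the zeros of \<open>h'\<close> and \<open>g'\<close>. The following definitions are the derivatives of \<open>E\<close> with respect to
\<open>z\<close> and to \<open>z\<close> and \<open>cnj z\<close>, the \<open>z\<close>-derivative of \<open>\<sigma>\<close>, and the Laplacian \<open>4 \<sigma>_zz'\<close> of \<open>\<sigma>\<close>.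
\<close>
definition E :: "complex \<Rightarrow> real" where
  "E z = (norm (deriv h z))\<^sup>2 + (norm (deriv g z))\<^sup>2 + 2 * (norm (deriv K z))\<^sup>2"

definition E_z :: "complex \<Rightarrow> complex" where
  "E_z z = (deriv ^^ 2) h z * cnj (deriv h z) + (deriv ^^ 2) g z * cnj (deriv g z)
             + 2 * (deriv ^^ 2) K z * cnj (deriv K z)"

definition E_zz :: "complex \<Rightarrow> real" where
  "E_zz z = (norm ((deriv ^^ 2) h z))\<^sup>2 + (norm ((deriv ^^ 2) g z))\<^sup>2 + 2 * (norm ((deriv ^^ 2) K z))\<^sup>2"

definition sigma_z :: "complex \<Rightarrow> complex" where
  "sigma_z z = E_z z / (2 * of_real (E z))"

definition lap_sigma :: "complex \<Rightarrow> real" where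
  "lap_sigma z = 2 * (E z * E_zz z - (norm (E_z z))\<^sup>2) / (E z)\<^sup>2"

lemma has_derivative_deriv:
  assumes "z \<in> ball 0 1"
  shows "(deriv h has_derivative (\<lambda>w. (deriv ^^ 2) h z * w)) (at z)"
    and "(deriv g has_derivative (\<lambda>w. (deriv ^^ 2) g z * w)) (at z)"
    and "(deriv K has_derivative (\<lambda>w. (deriv ^^ 2) K z * w)) (at z)"
    and "((deriv ^^ 2) h has_derivative (\<lambda>w. (deriv ^^ 3) h z * w)) (at z)"
    and "((deriv ^^ 2) g has_derivative (\<lambda>w. (deriv ^^ 3) g z * w)) (at z)"
    and "((deriv ^^ 2) K has_derivative (\<lambda>w. (deriv ^^ 3) K z * w)) (at z)"
proof -
  have *: "((deriv ^^ n) f has_derivative (\<lambda>w. (deriv ^^ Suc n) f z * w)) (at z)"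
    if "f holomorphic_on ball 0 1" for f n
    using holomorphic_derivI[OF holomorphic_higher_deriv[OF that open_ball] open_ball assms, of n UNIV]
    by (simp add: has_field_derivative_def)
  from *[of _ 1] *[of _ 2]
  show "(deriv h has_derivative (\<lambda>w. (deriv ^^ 2) h z * w)) (at z)"
    and "(deriv g has_derivative (\<lambda>w. (deriv ^^ 2) g z * w)) (at z)"
    and "(deriv K has_derivative (\<lambda>w. (deriv ^^ 2) K z * w)) (at z)"
    and "((deriv ^^ 2) h has_derivative (\<lambda>w. (deriv ^^ 3) h z * w)) (at z)"
    and "((deriv ^^ 2) g has_derivative (\<lambda>w. (deriv ^^ 3) g z * w)) (at z)"
    and "((deriv ^^ 2) K has_derivative (\<lambda>w. (deriv ^^ 3) K z * w)) (at z)"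
    using hol_h hol_g hol_K by (simp_all add: numeral_2_eq_2 numeral_3_eq_3)
qed

lemma null_deriv:
  assumes z: "z \<in> ball 0 1"
  shows "2 * deriv K z * (deriv ^^ 2) K z
    = (deriv ^^ 2) h z * deriv g z + deriv h z * (deriv ^^ 2) g z"
proof -
  note d = has_derivative_deriv[OF z]
  have "((\<lambda>z. (deriv K z)\<^sup>2) has_derivative (\<lambda>w. 2 * deriv K z * (deriv ^^ 2) K z * w)) (at z)"
    by (auto intro!: derivative_eq_intros d simp: algebra_simps)
  moreover have "((\<lambda>z. (deriv K z)\<^sup>2) has_derivative
      (\<lambda>w. ((deriv ^^ 2) h z * deriv g z + deriv h z * (deriv ^^ 2) g z) * w)) (at z)"
  proof (rule has_derivative_transform_within_open[OF _ open_ball z])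
    show "((\<lambda>z. deriv h z * deriv g z) has_derivative
      (\<lambda>w. ((deriv ^^ 2) h z * deriv g z + deriv h z * (deriv ^^ 2) g z) * w)) (at z)"
      by (auto intro!: derivative_eq_intros d simp: algebra_simps)
  qed (use null in auto)
  ultimately have "(\<lambda>w. 2 * deriv K z * (deriv ^^ 2) K z * w)
      = (\<lambda>w. ((deriv ^^ 2) h z * deriv g z + deriv h z * (deriv ^^ 2) g z) * w)"
    by (rule has_derivative_unique)
  from fun_cong[OF this, of 1] show ?thesis by simp
qed

lemmas normal_component = 
  normal_component_of_null_vector[OF null null_deriv immersed, folded E_def E_z_def E_zz_def]

lemma E_pos: "z \<in> ball 0 1 \<Longrightarrow> E z > 0"
  using normal_component(1) by blast

lemma lap_sigma_nonneg: "z \<in> ball 0 1 \<Longrightarrow> lap_sigma z \<ge> 0"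
  using normal_component(2)[of z] by (simp add: lap_sigma_def)

lemma conformal_factor:
  assumes z: "z \<in> ball 0 1"
  shows "(norm (deriv h z) + norm (deriv g z))\<^sup>2 = E z" 
proof -
  have "(norm (deriv K z))\<^sup>2 = norm (deriv h z) * norm (deriv g z)"
    using null[OF z] by (metis norm_mult norm_power)
  then show ?thesis by (simp add: E_def power2_sum)
qed

lemma conformal_log_eq:
  assumes z: "z \<in> ball 0 1"
  shows "conformal_log h g z = ln (E z) / 2"
proof -
  have "norm (deriv h z) + norm (deriv g z) > 0"
    using immersed[OF z] by (simp add: add_nonneg_nonneg order_less_le)
  then show ?thesis
    by (simp add: conformal_log_def conformal_factor[OF z, symmetric] ln_realpow)
qed

lemma E_has_derivative:
  assumes z: "z \<in> ball 0 1"
  shows "(E has_derivative (\<lambda>w. 2 * Re (E_z z * w))) (at z)"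
proof -
  note d = has_derivative_deriv[OF z]
  have eq: "E = (\<lambda>z. Re (deriv h z * cnj (deriv h z) + deriv g z * cnj (deriv g z)
                    + 2 * (deriv K z * cnj (deriv K z))))"
    by (rule ext) (simp only: complex_norm_square[symmetric] E_def, simp)
  show ?thesis
    unfolding eq E_z_def
    by (rule derivative_eq_intros has_derivative_cnj_compose d refl)+
       (auto simp: fun_eq_iff algebra_simps)
qed

lemma conformal_log_has_derivative:
  assumes z: "z \<in> ball 0 1"
  shows "(conformal_log h g has_derivative (\<lambda>w. 2 * Re (sigma_z z * w))) (at z)"
proof (rule has_derivative_transform_within_open[OF _ open_ball z])
  show "((\<lambda>z. ln (E z) / 2) has_derivative (\<lambda>w. 2 * Re (sigma_z z * w))) (at z)"
    using E_pos[OF z]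
    by (auto intro!: derivative_eq_intros E_has_derivative[OF z] simp: sigma_z_def fun_eq_iff field_simps)
qed (use conformal_log_eq in auto)

text \<open>
The coefficient \<open>s\<close> is \<open>\<sigma>_zz\<close>, which is known through the Schwarzian; the mixed derivative is a quarter of
the Laplacian.
\<close>
lemma sigma_z_has_derivative:
  assumes z: "z \<in> ball 0 1"
  obtains s where
    "(sigma_z has_derivative (\<lambda>w. s * w + of_real (lap_sigma z / 4) * cnj w)) (at z)"
proof -
  note d = has_derivative_deriv[OF z]
  define T where "T = (deriv ^^ 3) h z * cnj (deriv h z) + (deriv ^^ 3) g z * cnj (deriv g z)
             + 2 * (deriv ^^ 3) K z * cnj (deriv K z)"
  have dE: "(E_z has_derivative (\<lambda>w. T * w + of_real (E_zz z) * cnj w)) (at z)"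
    unfolding E_z_def[abs_def]
    by (rule derivative_eq_intros has_derivative_cnj_compose d refl)+
       (auto simp: fun_eq_iff T_def E_zz_def complex_norm_square algebra_simps simp del: of_real_power)
  have dEc: "((\<lambda>z. complex_of_real (E z)) has_derivative (\<lambda>w. E_z z * w + cnj (E_z z * w))) (at z)"
    using has_derivative_of_real[OF E_has_derivative[OF z]] by (simp only: complex_add_cnj)
  have E0: "complex_of_real (E z) \<noteq> 0" using E_pos[OF z] by simp
  define s where "s = (T * of_real (E z) - (E_z z)\<^sup>2) / (2 * of_real (E z) ^ 2)"
  have lap: "complex_of_real (lap_sigma z / 4) = (of_real (E z) * of_real (E_zz z) - E_z z * cnj (E_z z)) / (2 * of_real (E z) ^ 2)"
    unfolding lap_sigma_def using E0 by (simp add: of_real_norm_square divide_simps)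
  have "(sigma_z has_derivative (\<lambda>w. ((T * w + of_real (E_zz z) * cnj w) * (2 * of_real (E z))
          - E_z z * (2 * (E_z z * w + cnj (E_z z * w)))) / ((2 * of_real (E z)) * (2 * of_real (E z))))) (at z)"
    unfolding sigma_z_def[abs_def]
    using E0 by (intro has_derivative_divide' dE has_derivative_mult_right dEc) auto
  moreover have "((T * w + of_real (E_zz z) * cnj w) * (2 * of_real (E z))
          - E_z z * (2 * (E_z z * w + cnj (E_z z * w)))) / ((2 * of_real (E z)) * (2 * of_real (E z)))
      = s * w + of_real (lap_sigma z / 4) * cnj w" for w
    unfolding lap s_def using E0 by (simp add: field_simps power2_eq_square)
  ultimately show ?thesis using that[of s] by simp
qed

lemma wirtinger_sigma:
  assumes z: "z \<in> ball 0 1"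
  shows "wirtinger_z (\<lambda>w. complex_of_real (conformal_log h g w)) z = sigma_z z"
proof (rule wirtinger_z_of_has_derivative)
  show "((\<lambda>w. complex_of_real (conformal_log h g w)) has_derivative
      (\<lambda>w. sigma_z z * w + cnj (sigma_z z) * cnj w)) (at z)"
    by (rule has_derivative_eq_rhs[OF has_derivative_of_real[OF conformal_log_has_derivative[OF z]]])
       (simp add: fun_eq_iff complex_eq_iff)
qed

lemma schwarzian_and_laplacian:
  assumes z: "z \<in> ball 0 1"
    and s: "(sigma_z has_derivative (\<lambda>w. s * w + of_real (lap_sigma z / 4) * cnj w)) (at z)"
  shows "schwarzian h g z = 2 * (s - (sigma_z z)\<^sup>2)"
    and "laplacian (conformal_log h g) z = lap_sigma z"
proof -
  have "wirtinger_z (wirtinger_z (\<lambda>w. complex_of_real (conformal_log h g w))) z = s"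
    by (rule wirtinger_z_of_has_derivative, rule has_derivative_transform_within_open[OF s open_ball z])
       (simp add: wirtinger_sigma)
  then show "schwarzian h g z = 2 * (s - (sigma_z z)\<^sup>2)"
    by (simp add: schwarzian_def wirtinger_sigma[OF z])
  note p = partial_derivatives_of_has_derivative[OF conformal_log_has_derivative]
  have "(partial_x (conformal_log h g) has_derivative
      (\<lambda>w. 2 * Re (s * w + of_real (lap_sigma z / 4) * cnj w))) (at z)"
    by (rule has_derivative_transform_within_open[OF _ open_ball z, of "\<lambda>w. 2 * Re (sigma_z w)"])
       (auto intro!: derivative_eq_intros s simp: p)
  then have x: "partial_x (partial_x (conformal_log h g)) z = 2 * Re (s + of_real (lap_sigma z / 4))"
    by (simp add: partial_derivatives_of_has_derivative)
  have "(partial_y (conformal_log h g) has_derivative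
      (\<lambda>w. - 2 * Im (s * w + of_real (lap_sigma z / 4) * cnj w))) (at z)"
    by (rule has_derivative_transform_within_open[OF _ open_ball z, of "\<lambda>w. - 2 * Im (sigma_z w)"])
       (auto intro!: derivative_eq_intros s simp: p)
  then have y: "partial_y (partial_y (conformal_log h g)) z = - 2 * Im (s * \<i> + of_real (lap_sigma z / 4) * cnj \<i>)"
    by (simp add: partial_derivatives_of_has_derivative)
  show "laplacian (conformal_log h g) z = lap_sigma z"
    by (simp add: laplacian_def x y)
qed

text \<open>
Since \<open>E E_zz - |E_z|\<^sup>2 \<ge> 0\<close>, the function \<open>\<sigma>\<close> is subharmonic and the curvature is nonpositive.
\<close>
lemma curvature_term:
  assumes z: "z \<in> ball 0 1"
  shows "exp (2 * conformal_log h g z) * \<bar>gauss_curvature h g z\<bar> = lap_sigma z"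
proof -
  obtain s where "(sigma_z has_derivative (\<lambda>w. s * w + of_real (lap_sigma z / 4) * cnj w)) (at z)"
    using sigma_z_has_derivative[OF z] .
  then show ?thesis
    using schwarzian_and_laplacian(2)[OF z] lap_sigma_nonneg[OF z]
    by (simp add: gauss_curvature_def abs_mult exp_minus flip: exp_add)
qed

end

section \<open>The comparison metric\<close>

lemma has_vector_derivative_compose:
  assumes "(F has_derivative D) (at (z x))" and "(z has_vector_derivative v) (at x)"
  shows "((\<lambda>x. F (z x)) has_vector_derivative D v) (at x)"
proof -
  interpret D: bounded_linear D using assms(1) by (rule has_derivative_bounded_linear)
  show ?thesis
    using has_derivative_compose[OF assms(2)[unfolded has_vector_derivative_def] assms(1)]
    by (simp add: has_vector_derivative_def D.scaleR)
qed

text \<open>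
The \<open>z\<close>-derivative of \<open>\<phi> = - t ln (1 - |z|\<^sup>2)\<close>, the logarithm of the conformal factor of the comparison metric.
\<close>
definition phi_z :: "real \<Rightarrow> complex \<Rightarrow> complex" where
  "phi_z t z = of_real t * cnj z / of_real (1 - (norm z)\<^sup>2)"

lemma one_minus_norm_square_has_derivative:
  "((\<lambda>z. 1 - (norm z)\<^sup>2) has_derivative (\<lambda>v. - 2 * Re (cnj z * v))) (at (z::complex))"
proof -
  have eq: "(\<lambda>z. 1 - (norm z)\<^sup>2) = (\<lambda>z. 1 - Re (z * cnj z))"
    by (simp add: fun_eq_iff flip: complex_norm_square)
  show ?thesis unfolding eq
    by (rule derivative_eq_intros has_derivative_cnj_compose refl)+ (auto simp: fun_eq_iff algebra_simps)
qed

lemma one_minus_norm_square_pos: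
  "z \<in> ball 0 1 \<Longrightarrow> 1 - (norm (z::complex))\<^sup>2 > 0"
  by (simp add: power_less_one_iff abs_square_less_1)

lemma phi_has_derivative:
  assumes z: "z \<in> ball 0 1"
  shows "((\<lambda>z. - t * ln (1 - (norm z)\<^sup>2)) has_derivative (\<lambda>v. 2 * Re (phi_z t z * v))) (at z)"
  using one_minus_norm_square_pos[OF z]
  by (auto intro!: derivative_eq_intros one_minus_norm_square_has_derivative
       simp: phi_z_def fun_eq_iff Re_divide_of_real inner_complex_def field_simps)

lemma phi_z_has_derivative:
  assumes z: "z \<in> ball 0 1"
  shows "(phi_z t has_derivative (\<lambda>v. of_real t * (cnj z)\<^sup>2 / (of_real (1 - (norm z)\<^sup>2))\<^sup>2 * v
           + of_real (t / (1 - (norm z)\<^sup>2)\<^sup>2) * cnj v)) (at z)"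
proof -
  define d where "d = 1 - (norm z)\<^sup>2"
  have d: "d > 0" using one_minus_norm_square_pos[OF z] by (simp add: d_def)
  have zz: "z * cnj z = of_real (1 - d)" by (simp add: d_def of_real_norm_square)
  have "((\<lambda>z. complex_of_real (1 - (norm z)\<^sup>2)) has_derivative (\<lambda>v. - (cnj z * v + z * cnj v))) (at z)"
    by (rule has_derivative_eq_rhs[OF has_derivative_of_real[OF one_minus_norm_square_has_derivative]])
       (simp add: fun_eq_iff complex_eq_iff)
  then have "(phi_z t has_derivative (\<lambda>v. ((of_real t * cnj v) * of_real d
          - of_real t * cnj z * (- (cnj z * v + z * cnj v))) / (of_real d * of_real d))) (at z)"
    unfolding phi_z_def[abs_def] d_def using d[unfolded d_def]
    by (intro has_derivative_divide' has_derivative_mult_right has_derivative_cnj_compose has_derivative_ident)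
       (simp_all del: of_real_diff of_real_power)
  moreover have "((of_real t * cnj v) * of_real d - of_real t * cnj z * (- (cnj z * v + z * cnj v))) / (of_real d * of_real d)
      = of_real t * (cnj z)\<^sup>2 / (of_real d)\<^sup>2 * v + of_real (t / d\<^sup>2) * cnj v" for v
  proof -
    have e: "cnj z * (z * cnj v) = of_real (1 - d) * cnj v"
      unfolding zz[symmetric] by simp
    have "(of_real t * cnj v) * of_real d - of_real t * cnj z * (- (cnj z * v + z * cnj v))
        = of_real t * (cnj v * of_real d + cnj z * cnj z * v + cnj z * (z * cnj v))"
      by (simp add: algebra_simps)
    then have "(of_real t * cnj v) * of_real d - of_real t * cnj z * (- (cnj z * v + z * cnj v))
        = of_real t * (cnj z)\<^sup>2 * v + of_real t * cnj v"
      unfolding e by (simp add: algebra_simps power2_eq_square)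
    then show ?thesis using d by (simp add: field_simps power2_eq_square)
  qed
  ultimately show ?thesis by (simp add: d_def)
qed

section \<open>The differential inequality along geodesics\<close>

text \<open>
The numbers \<open>u1\<close> and \<open>u2\<close> are the first two derivatives of \<open>ln N + \<phi> - \<sigma> = 2 ln v\<close> along a unit speed geodesic
with velocity \<open>w\<close>, where \<open>N = |F - P|\<^sup>2\<close>, so that \<open>u2 / 2 + u1\<^sup>2 / 4 = v'' / v\<close>. The letters \<open>f\<close>, \<open>f2\<close>, \<open>f3\<close> are
\<open>\<phi>_z\<close>, \<open>\<phi>_zz\<close> and the mixed derivative of \<open>\<phi>\<close>, and \<open>a\<close>, \<open>s\<close>, \<open>D / 4\<close> are those of \<open>\<sigma>\<close>.

The terms that are bilinear in the derivative of \<open>N\<close> and in that of \<open>\<phi> - \<sigma>\<close> cancel up to a square, because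
\<open>w' = - 2 f w\<^sup>2\<close>. What remains of \<open>ln N\<close> is \<open>|w|\<^sup>2 R / N\<^sup>2\<close>, which comes from the normal component of the chord,
and the term \<open>Re (\<mu> w\<^sup>2) / N\<close> of the second fundamental form; their sum is at least \<open>- D |w|\<^sup>2 / 4\<close> by
completing the square. Together with the mixed
derivative of \<open>- \<sigma>\<close> this produces the full curvature term \<open>D / 2\<close>.
\<close>
lemma second_derivative_estimate:
  fixes w \<alpha> \<mu> a s f f2 :: complex and N E D f3 u1 u2 :: real
  assumes N: "N > 0" and D: "D \<ge> 0" and R: "E * N - (norm \<alpha>)\<^sup>2 \<ge> 0"
    and mu: "(norm \<mu>)\<^sup>2 = D * (E * N - (norm \<alpha>)\<^sup>2)"
    and u1: "u1 = 2 * Re (\<alpha> * w) / N + 2 * Re ((f - a) * w)"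
    and u2: "u2 = (2 * Re ((\<mu> + 2 * a * \<alpha>) * w\<^sup>2 + \<alpha> * (- 2 * f * w\<^sup>2)) + 2 * E * (norm w)\<^sup>2) / N
        - (2 * Re (\<alpha> * w))\<^sup>2 / N\<^sup>2 + 2 * Re ((f - a) * (- 2 * f * w\<^sup>2))
        + 2 * Re ((f2 - s) * w\<^sup>2) + 2 * (f3 - D / 4) * (norm w)\<^sup>2"
  shows "u2 / 2 + u1\<^sup>2 / 4 \<ge> (norm w)\<^sup>2 * (f3 - (norm (2 * (s - a\<^sup>2) - 2 * (f2 - f\<^sup>2)) + D) / 2)"
proof -
  define X G A T M where "X = \<alpha> * w" and "G = f * w" and "A = a * w"
    and "T = (f2 - s) * w\<^sup>2" and "M = \<mu> * w\<^sup>2"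
  define R where "R = E * N - (norm \<alpha>)\<^sup>2"
  have R0: "R \<ge> 0" using R by (simp add: R_def)
  have u1': "u1 = 2 * Re X / N + 2 * Re (G - A)"
    by (simp add: u1 X_def G_def A_def algebra_simps)
  have e1: "(\<mu> + 2 * a * \<alpha>) * w\<^sup>2 + \<alpha> * (- 2 * f * w\<^sup>2) = M + 2 * A * X - 2 * G * X"
    by (simp add: X_def G_def A_def M_def power2_eq_square algebra_simps)
  have e2: "(f - a) * (- 2 * f * w\<^sup>2) = - 2 * G * (G - A)"
    by (simp add: G_def A_def power2_eq_square algebra_simps)
  have u2': "u2 = (2 * Re (M + 2 * A * X - 2 * G * X) + 2 * E * (norm w)\<^sup>2) / N
        - (2 * Re X)\<^sup>2 / N\<^sup>2 + 2 * Re (- 2 * G * (G - A)) + 2 * Re T + 2 * (f3 - D / 4) * (norm w)\<^sup>2"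
    unfolding u2 e1 e2 by (simp add: X_def T_def)
  have EN: "E * (norm w)\<^sup>2 / N = (norm w)\<^sup>2 * R / N\<^sup>2 + ((Re X)\<^sup>2 + (Im X)\<^sup>2) / N\<^sup>2"
  proof -
    have "(Re X)\<^sup>2 + (Im X)\<^sup>2 = (norm \<alpha>)\<^sup>2 * (norm w)\<^sup>2"
      unfolding cmod_power2[symmetric] by (simp add: X_def norm_mult power_mult_distrib)
    then show ?thesis using N by (simp add: R_def field_simps power2_eq_square)
  qed
  \<comment> \<open>The derivatives of \<open>N\<close> and of \<open>\<phi> - \<sigma>\<close> across the geodesic combine to the square of \<open>Im X / N + Im (G - A)\<close>.\<close>
  have "u2 / 2 + u1\<^sup>2 / 4 = (norm w)\<^sup>2 * R / N\<^sup>2 + (Im X / N + Im (G - A))\<^sup>2 + Re M / N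
      + Re (T - G\<^sup>2 + A\<^sup>2) + (f3 - D / 4) * (norm w)\<^sup>2"
  proof -
    define i where "i = inverse N"
    have i: "x / N = x * i" "x / N\<^sup>2 = x * i\<^sup>2" for x
      by (simp_all add: i_def divide_inverse power_inverse)
    have "u2 / 2 = Re (M + 2 * A * X - 2 * G * X) * i + E * (norm w)\<^sup>2 / N
        - 2 * (Re X * i)\<^sup>2 + Re (- 2 * G * (G - A)) + Re T + (f3 - D / 4) * (norm w)\<^sup>2"
      unfolding u2' i by (simp add: field_simps power2_eq_square)
    moreover have "u1\<^sup>2 / 4 = (Re X * i + Re (G - A))\<^sup>2"
      unfolding u1' i by (simp add: field_simps power2_eq_square)
    moreover have "(Im X / N + Im (G - A))\<^sup>2 = (Im X * i + Im (G - A))\<^sup>2" "Re M / N = Re M * i"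
       "((Re X)\<^sup>2 + (Im X)\<^sup>2) / N\<^sup>2 = ((Re X)\<^sup>2 + (Im X)\<^sup>2) * i\<^sup>2"
      by (simp_all add: i_def divide_inverse power_inverse)
    ultimately show ?thesis unfolding EN
      by (simp add: power2_eq_square algebra_simps)
  qed
  moreover have "Re M / N \<ge> - ((norm w)\<^sup>2 * R / N\<^sup>2) - (norm w)\<^sup>2 * D / 4"
  proof -
    \<comment> \<open>Completing the square: \<open>|\<mu>| = sqrt (D R)\<close>.\<close>
    have "sqrt D * sqrt R / N \<le> R / N\<^sup>2 + D / 4"
      using zero_le_power2[of "sqrt R / N - sqrt D / 2"] R0 D
      by (simp add: power2_diff power_divide mult.commute)
    then have "norm \<mu> / N \<le> R / N\<^sup>2 + D / 4"
      using real_sqrt_unique[OF mu] by (simp add: real_sqrt_mult R_def)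
    then have "(norm w)\<^sup>2 * (norm \<mu> / N) \<le> (norm w)\<^sup>2 * (R / N\<^sup>2 + D / 4)"
      by (rule mult_left_mono) simp
    moreover have "Re M / N \<ge> - (norm w)\<^sup>2 * (norm \<mu> / N)"
      using abs_Re_le_cmod[of M] N by (simp add: M_def norm_mult norm_power divide_simps mult.commute)
    ultimately show ?thesis by (simp add: algebra_simps)
  qed
  moreover have "Re (T - G\<^sup>2 + A\<^sup>2) \<ge> - (norm w)\<^sup>2 * norm (2 * (s - a\<^sup>2) - 2 * (f2 - f\<^sup>2)) / 2"
  proof -
    have "T - G\<^sup>2 + A\<^sup>2 = - (2 * (s - a\<^sup>2) - 2 * (f2 - f\<^sup>2)) * w\<^sup>2 / 2"
      by (simp add: T_def G_def A_def power2_eq_square algebra_simps)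
    then have "norm (T - G\<^sup>2 + A\<^sup>2) = (norm w)\<^sup>2 * norm (2 * (s - a\<^sup>2) - 2 * (f2 - f\<^sup>2)) / 2"
      by (simp only: norm_mult norm_divide norm_power norm_minus_cancel) simp
    then show ?thesis using abs_Re_le_cmod[of "T - G\<^sup>2 + A\<^sup>2"] by simp
  qed
  moreover have "(norm w)\<^sup>2 * (f3 - (norm (2 * (s - a\<^sup>2) - 2 * (f2 - f\<^sup>2)) + D) / 2)
      = (f3 - D / 4) * (norm w)\<^sup>2 - (norm w)\<^sup>2 * D / 4
        + - (norm w)\<^sup>2 * norm (2 * (s - a\<^sup>2) - 2 * (f2 - f\<^sup>2)) / 2"
    by (simp add: field_simps)
  ultimately show ?thesis
    using zero_le_power2[of "Im X / N + Im (G - A)"] by linarith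
qed

context weierstrass_data
begin

context
  fixes p :: complex and r :: real
begin

text \<open>
The displacement from the point with horizontal part \<open>p\<close> and height \<open>r\<close> to the lift of \<open>z\<close>, and the square \<open>dist2\<close>
of its length. Then \<open>dist2_z\<close> is the bilinear product of the displacement with the null vector \<open>\<Phi>\<close> of the
surface, and \<open>dist2_normal\<close> that with the normal vector \<open>\<Phi>' - 2 \<sigma>_z \<Phi>\<close>.
\<close>
definition horizontal :: "complex \<Rightarrow> complex" where "horizontal z = h z + cnj (g z) - p"
definition vertical :: "complex \<Rightarrow> real" where "vertical z = 2 * Im (K z) - r"
definition dist2 :: "complex \<Rightarrow> real" where "dist2 z = (norm (horizontal z))\<^sup>2 + (vertical z)\<^sup>2"
definition dist2_z :: "complex \<Rightarrow> complex" where
  "dist2_z z = deriv h z * cnj (horizontal z) + deriv g z * horizontal z - 2 * \<i> * deriv K z * of_real (vertical z)"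
definition dist2_normal :: "complex \<Rightarrow> complex" where
  "dist2_normal z = (deriv ^^ 2) h z * cnj (horizontal z) + (deriv ^^ 2) g z * horizontal z
     - 2 * \<i> * (deriv ^^ 2) K z * of_real (vertical z) - 2 * sigma_z z * dist2_z z"

lemma norm_dist2_normal:
  assumes z: "z \<in> ball 0 1"
  shows "(norm (dist2_normal z))\<^sup>2 = lap_sigma z * (E z * dist2 z - (norm (dist2_z z))\<^sup>2)"
    and "E z * dist2 z - (norm (dist2_z z))\<^sup>2 \<ge> 0"
  using normal_component(3,4)[OF z z z, of "horizontal z" "vertical z"]
  by (simp_all add: dist2_normal_def dist2_z_def[symmetric] dist2_def[symmetric] lap_sigma_def sigma_z_def)

lemma displacement_has_derivative:
  assumes z: "z \<in> ball 0 1"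
  shows "(horizontal has_derivative (\<lambda>v. deriv h z * v + cnj (deriv g z * v))) (at z)"
    and "(vertical has_derivative (\<lambda>v. 2 * Im (deriv K z * v))) (at z)"
proof -
  have *: "(f has_derivative (\<lambda>v. deriv f z * v)) (at z)" if "f holomorphic_on ball 0 1" for f
    using holomorphic_derivI[OF that open_ball z, of UNIV] by (simp add: has_field_derivative_def)
  show "(horizontal has_derivative (\<lambda>v. deriv h z * v + cnj (deriv g z * v))) (at z)"
    unfolding horizontal_def[abs_def]
    by (auto intro!: derivative_eq_intros has_derivative_cnj_compose * hol_h hol_g simp: fun_eq_iff)
  show "(vertical has_derivative (\<lambda>v. 2 * Im (deriv K z * v))) (at z)"
    unfolding vertical_def[abs_def]
    by (auto intro!: derivative_eq_intros * hol_K simp: fun_eq_iff)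
qed

lemma dist2_has_derivative:
  assumes z: "z \<in> ball 0 1"
  shows "(dist2 has_derivative (\<lambda>v. 2 * Re (dist2_z z * v))) (at z)"
proof -
  have eq: "dist2 = (\<lambda>z. Re (horizontal z * cnj (horizontal z)) + (vertical z)\<^sup>2)"
    by (simp add: fun_eq_iff dist2_def flip: complex_norm_square)
  show ?thesis unfolding eq
    by (rule derivative_eq_intros has_derivative_cnj_compose displacement_has_derivative[OF z] refl)+
       (auto simp: fun_eq_iff dist2_z_def algebra_simps)
qed

lemma dist2_z_has_derivative:
  assumes z: "z \<in> ball 0 1"
  shows "(dist2_z has_derivative
    (\<lambda>v. (dist2_normal z + 2 * sigma_z z * dist2_z z) * v + of_real (E z) * cnj v)) (at z)"
proof -
  note d = has_derivative_deriv[OF z]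
  have Ez: "complex_of_real (E z) = deriv h z * cnj (deriv h z) + deriv g z * cnj (deriv g z)
              + 2 * (deriv K z * cnj (deriv K z))"
    by (simp add: E_def of_real_norm_square)
  have im: "2 * \<i> * of_real (2 * Im x) = 2 * (x - cnj x)" for x
    by (simp add: complex_eq_iff)
  have "(dist2_z has_derivative (\<lambda>v.
      (deriv h z * cnj (deriv h z * v + cnj (deriv g z * v)) + (deriv ^^ 2) h z * v * cnj (horizontal z)
       + (deriv g z * (deriv h z * v + cnj (deriv g z * v)) + (deriv ^^ 2) g z * v * horizontal z))
      - (2 * \<i> * deriv K z * of_real (2 * Im (deriv K z * v)) + 2 * \<i> * ((deriv ^^ 2) K z * v) * of_real (vertical z)))) (at z)"
    unfolding dist2_z_def[abs_def]
    by (intro has_derivative_diff has_derivative_add has_derivative_mult has_derivative_mult_right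
         has_derivative_cnj_compose has_derivative_of_real displacement_has_derivative[OF z] d)
  note dz = this
  have im2: "2 * \<i> * deriv K z * of_real (2 * Im (deriv K z * v))
      = 2 * (deriv h z * deriv g z) * v - 2 * deriv K z * cnj (deriv K z * v)" for v
  proof -
    have "2 * \<i> * deriv K z * of_real (2 * Im (deriv K z * v))
      = deriv K z * (2 * \<i> * of_real (2 * Im (deriv K z * v)))" by (simp only: mult_ac)
    also have "\<dots> = 2 * (deriv K z)\<^sup>2 * v - 2 * deriv K z * cnj (deriv K z * v)"
      unfolding im by (simp add: algebra_simps power2_eq_square)
    finally show ?thesis by (simp only: null[OF z])
  qed
  show ?thesis
    by (rule has_derivative_eq_rhs[OF dz], rule ext, unfold im2 Ez dist2_normal_def)
       (simp add: algebra_simps)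
qed

text \<open>
The curve is a geodesic of the comparison metric with unit velocity \<open>w\<close>, traversed with speed \<open>l\<close>; all
derivatives are taken with respect to a parameter \<open>x\<close>, whence the factors \<open>l\<close>.
\<close>
lemma log_distance_along_curve:
  fixes z w :: "real \<Rightarrow> complex" and l :: real
  assumes zx: "z x \<in> ball 0 1" and pos: "dist2 (z x) > 0"
    and dz: "(z has_vector_derivative of_real l * w x) (at x)"
    and dw: "(w has_vector_derivative of_real l * (- 2 * phi_z t (z x) * (w x)\<^sup>2)) (at x)"
  defines "u \<equiv> (\<lambda>x. ln (dist2 (z x)) - t * ln (1 - (norm (z x))\<^sup>2) - conformal_log h g (z x))"
    and "u1 \<equiv> (\<lambda>x. 2 * Re (dist2_z (z x) * w x) / dist2 (z x) + 2 * Re ((phi_z t (z x) - sigma_z (z x)) * w x))"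
  shows "(u has_real_derivative l * u1 x) (at x)"
    and "\<exists>u2. (u1 has_real_derivative l * u2) (at x) \<and>
       u2 / 2 + (u1 x)\<^sup>2 / 4 \<ge> (norm (w x))\<^sup>2 * (t / (1 - (norm (z x))\<^sup>2)\<^sup>2
         - (norm (schwarzian h g (z x) - of_real (2 * t * (1 - t)) * (cnj (z x))\<^sup>2 / of_real ((1 - (norm (z x))\<^sup>2)\<^sup>2))
            + exp (2 * conformal_log h g (z x)) * \<bar>gauss_curvature h g (z x)\<bar>) / 2)"
proof -
  note chain = has_vector_derivative_compose[OF _ dz]
  note dN = chain[OF dist2_has_derivative[OF zx]]
  note d\<phi> = chain[OF phi_has_derivative[OF zx, of t]]
  note d\<sigma> = chain[OF conformal_log_has_derivative[OF zx]]
  show "(u has_real_derivative l * u1 x) (at x)"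
  proof -
    have 1: "((\<lambda>x. dist2 (z x)) has_real_derivative 2 * l * Re (dist2_z (z x) * w x)) (at x)"
      using dN by (simp add: has_real_derivative_iff_has_vector_derivative algebra_simps)
    have 2: "((\<lambda>x. - t * ln (1 - (norm (z x))\<^sup>2)) has_real_derivative 2 * l * Re (phi_z t (z x) * w x)) (at x)"
      using d\<phi> by (simp add: has_real_derivative_iff_has_vector_derivative algebra_simps)
    have 3: "((\<lambda>x. conformal_log h g (z x)) has_real_derivative 2 * l * Re (sigma_z (z x) * w x)) (at x)"
      using d\<sigma> by (simp add: has_real_derivative_iff_has_vector_derivative algebra_simps)
    have 4: "((\<lambda>x. ln (dist2 (z x))) has_real_derivative 2 * l * Re (dist2_z (z x) * w x) / dist2 (z x)) (at x)"
      using pos by (auto intro!: derivative_eq_intros 1)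
    show ?thesis
      using DERIV_diff[OF DERIV_add[OF 4 2] 3] unfolding u_def u1_def by (simp add: algebra_simps)
  qed
  obtain s where s: "(sigma_z has_derivative (\<lambda>v. s * v + of_real (lap_sigma (z x) / 4) * cnj v)) (at (z x))"
    using sigma_z_has_derivative[OF zx] .
  define f2 where "f2 = of_real t * (cnj (z x))\<^sup>2 / (of_real (1 - (norm (z x))\<^sup>2))\<^sup>2"
  define f3 where "f3 = t / (1 - (norm (z x))\<^sup>2)\<^sup>2"
  define W where "W = w x"
  define \<alpha> where "\<alpha> = dist2_z (z x)"
  define \<mu> where "\<mu> = dist2_normal (z x)"
  define a where "a = sigma_z (z x)"
  define f where "f = phi_z t (z x)"
  define N where "N = dist2 (z x)"
  define e where "e = E (z x)"
  define D where "D = lap_sigma (z x)"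
  define u2 where "u2 = (2 * Re ((\<mu> + 2 * a * \<alpha>) * W\<^sup>2 + \<alpha> * (- 2 * f * W\<^sup>2)) + 2 * e * (norm W)\<^sup>2) / N
        - (2 * Re (\<alpha> * W))\<^sup>2 / N\<^sup>2 + 2 * Re ((f - a) * (- 2 * f * W\<^sup>2))
        + 2 * Re ((f2 - s) * W\<^sup>2) + 2 * (f3 - D / 4) * (norm W)\<^sup>2"
  have "u2 / 2 + (u1 x)\<^sup>2 / 4 \<ge> (norm W)\<^sup>2 * (f3 - (norm (2 * (s - a\<^sup>2) - 2 * (f2 - f\<^sup>2)) + D) / 2)"
    by (rule second_derivative_estimate[of N D e \<alpha> \<mu>])
       (use pos lap_sigma_nonneg[OF zx] norm_dist2_normal[OF zx] in
         \<open>simp_all add: u2_def u1_def \<alpha>_def \<mu>_def a_def f_def N_def e_def D_def W_def\<close>)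
  moreover have "2 * (s - a\<^sup>2) = schwarzian h g (z x)"
    using schwarzian_and_laplacian(1)[OF zx s] by (simp add: a_def)
  moreover have "2 * (f2 - f\<^sup>2) = of_real (2 * t * (1 - t)) * (cnj (z x))\<^sup>2 / of_real ((1 - (norm (z x))\<^sup>2)\<^sup>2)"
    unfolding f2_def f_def phi_z_def
    by (simp add: power_divide power_mult_distrib diff_divide_distrib[symmetric] algebra_simps power2_eq_square)
  moreover have "(u1 has_real_derivative l * u2) (at x)"
  proof -
    have 1: "((\<lambda>x. dist2 (z x)) has_derivative (\<lambda>y. y * (2 * l * Re (\<alpha> * W)))) (at x)"
      using dN by (simp add: has_vector_derivative_def algebra_simps \<alpha>_def W_def)
    have 2: "((\<lambda>x. dist2_z (z x)) has_derivative (\<lambda>y. of_real y * (of_real l * ((\<mu> + 2 * a * \<alpha>) * W + of_real e * cnj W)))) (at x)"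
      using chain[OF dist2_z_has_derivative[OF zx]]
      by (simp add: has_vector_derivative_def algebra_simps scaleR_conv_of_real \<alpha>_def \<mu>_def W_def a_def e_def)
    have 3: "((\<lambda>x. phi_z t (z x)) has_derivative (\<lambda>y. of_real y * (of_real l * (f2 * W + of_real f3 * cnj W)))) (at x)"
      using chain[OF phi_z_has_derivative[OF zx], of t, folded f2_def f3_def]
      by (simp add: has_vector_derivative_def algebra_simps scaleR_conv_of_real W_def)
    have 4: "((\<lambda>x. sigma_z (z x)) has_derivative (\<lambda>y. of_real y * (of_real l * (s * W + of_real (D / 4) * cnj W)))) (at x)"
      using chain[OF s]
      by (simp add: has_vector_derivative_def algebra_simps scaleR_conv_of_real W_def D_def)
    have 5: "(w has_derivative (\<lambda>y. of_real y * (of_real l * (- 2 * f * W\<^sup>2)))) (at x)"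
      using dw by (simp add: has_vector_derivative_def scaleR_conv_of_real f_def W_def)
    have nW: "(norm W)\<^sup>2 = (Re W)\<^sup>2 + (Im W)\<^sup>2" by (rule cmod_power2)
    have N0: "dist2 (z x) \<noteq> 0" using pos by simp
    show ?thesis
      unfolding u1_def has_field_derivative_def
      apply (rule derivative_eq_intros 1 2 3 4 5 N0 refl)+
      apply (rule ext)
      apply (fold \<alpha>_def a_def f_def N_def W_def)
      apply (simp add: u2_def nW)
      apply (use pos in \<open>simp add: field_simps power2_eq_square N_def[symmetric]\<close>)
      done
  qed
  ultimately show "\<exists>u2. (u1 has_real_derivative l * u2) (at x) \<and>
       u2 / 2 + (u1 x)\<^sup>2 / 4 \<ge> (norm (w x))\<^sup>2 * (t / (1 - (norm (z x))\<^sup>2)\<^sup>2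
         - (norm (schwarzian h g (z x) - of_real (2 * t * (1 - t)) * (cnj (z x))\<^sup>2 / of_real ((1 - (norm (z x))\<^sup>2)\<^sup>2))
            + exp (2 * conformal_log h g (z x)) * \<bar>gauss_curvature h g (z x)\<bar>) / 2)"
    unfolding curvature_term[OF zx] by (auto simp: f3_def D_def W_def)
qed

end

end

section \<open>Sturm comparison\<close>

lemma derivative_unbounded_at_pole:
  fixes u u' :: "real \<Rightarrow> real"
  assumes "a < c" and lim: "filterlim u at_bot (at_right a)"
    and der: "\<And>x. a < x \<Longrightarrow> x < c \<Longrightarrow> (u has_real_derivative u' x) (at x)"
  shows "\<exists>x. a < x \<and> x < c \<and> u' x > K"
proof (rule ccontr)
  assume "\<not> ?thesis"
  then have le: "u' x \<le> K" if "a < x" "x < c" for x using that by force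
  define d where "d = (a + c) / 2"
  have d: "a < d" "d < c" using \<open>a < c\<close> by (auto simp: d_def)
  define L where "L = u d - \<bar>K\<bar> * (d - a)"
  have low: "u x \<ge> L" if x: "a < x" "x < d" for x
  proof -
    obtain y where y: "x < y" "y < d" "u d - u x = (d - x) * u' y"
      using MVT2[of x d u u'] der x d by force
    have "(d - x) * u' y \<le> (d - x) * \<bar>K\<bar>"
      using le[of y] y x d by (intro mult_left_mono) auto
    also have "\<dots> \<le> (d - a) * \<bar>K\<bar>"
      using x by (intro mult_right_mono) auto
    finally show ?thesis using y by (simp add: L_def mult.commute)
  qed
  have "\<forall>\<^sub>F x in at_right a. u x < L"
    using lim by (simp add: filterlim_at_bot_dense)
  moreover have "\<forall>\<^sub>F x in at_right a. x < d \<and> a < x"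
    using eventually_at_right[OF \<open>a < d\<close>] d by auto
  ultimately have "\<forall>\<^sub>F x in at_right a. False"
    by eventually_elim (use low in force)
  then show False by simp
qed

text \<open>
Sturm comparison for \<open>v = exp (u / 2)\<close>, which vanishes at both ends: if \<open>v'' \<ge> - \<kappa>\<^sup>2 v\<close> in the arc length with
element \<open>l dx\<close>, then the ends have distance at least \<open>\<pi> / \<kappa>\<close>. The logarithmic derivative \<open>\<rho> = u1 / 2\<close> of \<open>v\<close>
satisfies \<open>\<rho>' \<ge> - (\<kappa>\<^sup>2 + \<rho>\<^sup>2)\<close>, so that the angle \<open>arctan (\<rho> / \<kappa>)\<close> decreases at most at the rate \<open>\<kappa>\<close>. But near the
left end \<open>\<rho>\<close> takes arbitrarily large values, and near the right end arbitrarily large negative ones, so that the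
angle has to drop by \<open>\<pi>\<close>.
\<close>
lemma riccati_comparison:
  fixes u u1 u2 l :: "real \<Rightarrow> real"
  assumes "a < b" and contl: "continuous_on {a..b} l" and lpos: "\<And>x. a \<le> x \<Longrightarrow> x \<le> b \<Longrightarrow> l x > 0"
    and der1: "\<And>x. a < x \<Longrightarrow> x < b \<Longrightarrow> (u has_real_derivative l x * u1 x) (at x)"
    and der2: "\<And>x. a < x \<Longrightarrow> x < b \<Longrightarrow> (u1 has_real_derivative l x * u2 x) (at x)"
    and ineq: "\<And>x. a < x \<Longrightarrow> x < b \<Longrightarrow> u2 x / 2 + (u1 x)\<^sup>2 / 4 \<ge> - \<kappa>\<^sup>2"
    and "\<kappa> > 0"
    and lim_a: "filterlim u at_bot (at_right a)" and lim_b: "filterlim u at_bot (at_left b)"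
  shows "\<kappa> * integral {a..b} l \<ge> pi"
proof (rule ccontr)
  define I where "I = integral {a..b} l"
  assume "\<not> ?thesis"
  then have I_less: "\<kappa> * I < pi" by (simp add: I_def)
  have int: "l integrable_on {x..y}" if "a \<le> x" "y \<le> b" for x y
    using that by (intro integrable_continuous_real continuous_on_subset[OF contl]) auto
  have I0: "I \<ge> 0"
    unfolding I_def using int lpos by (intro integral_nonneg) (auto simp: less_imp_le)
  obtain M where M: "\<And>x. x \<in> {a..b} \<Longrightarrow> l x \<le> M"
    using continuous_attains_sup[OF compact_Icc _ contl] \<open>a < b\<close> by fastforce
  have M0: "M > 0" using M[of a] lpos[of a] \<open>a < b\<close> by force
  \<comment> \<open>An angle strictly between \<open>\<kappa> I / 2\<close> and \<open>\<pi> / 2\<close>; a drop from \<open>y\<close> to \<open>- y\<close> is already too much for the length \<open>I\<close>.\<close>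
  define y where "y = (\<kappa> * I / 2 + pi / 2) / 2"
  have y: "\<kappa> * I < 2 * y" "0 < y" "y < pi / 2"
    using I_less mult_nonneg_nonneg[OF less_imp_le[OF \<open>\<kappa> > 0\<close>] I0] pi_gt_zero
    unfolding y_def by argo+
  define K where "K = 2 * \<kappa> * tan y"
  have K0: "K > 0" using y \<open>\<kappa> > 0\<close> by (simp add: K_def tan_gt_zero)
  have arctanK: "arctan (K / (2 * \<kappa>)) = y"
    using y \<open>\<kappa> > 0\<close> by (simp add: K_def arctan_tan)
  have large: "s > K" if "l x * s > M * K" "x \<in> {a..b}" for s x
  proof -
    have "l x > 0" "l x \<le> M" using that M lpos by auto
    have "M * K > 0" using M0 K0 by simp
    then have "l x * s > 0" using that by linarith
    then have "s > 0" using \<open>l x > 0\<close> by (simp add: zero_less_mult_iff)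
    then have "l x * s \<le> M * s" using \<open>l x \<le> M\<close> by (intro mult_right_mono) auto
    then have "M * K < M * s" using that by linarith
    then show ?thesis using M0 by simp
  qed
  define c where "c = (a + b) / 2"
  have c: "a < c" "c < b" using \<open>a < b\<close> by (auto simp: c_def)
  obtain x1 where x1: "a < x1" "x1 < c" "l x1 * u1 x1 > M * K"
    using derivative_unbounded_at_pole[OF c(1) lim_a, of "\<lambda>x. l x * u1 x" "M * K"] der1 c by force
  have lim_b': "filterlim (\<lambda>x. u (- x)) at_bot (at_right (- b))"
    using lim_b by (simp add: at_left_minus filterlim_filtermap)
  have der_b': "((\<lambda>x. u (- x)) has_real_derivative - (l (- x) * u1 (- x))) (at x)"
    if "- b < x" "x < - c" for x
    using DERIV_chain2[of u "l (- x) * u1 (- x)" "\<lambda>x. - x" x "-1" UNIV] der1[of "- x"] that c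
      DERIV_minus[OF DERIV_ident, of x] by simp
  obtain x2' where x2': "- b < x2'" "x2' < - c" "- (l (- x2') * u1 (- x2')) > M * K"
    using derivative_unbounded_at_pole[OF _ lim_b' der_b', of "- c" "M * K"] c by auto
  define x2 where "x2 = - x2'"
  have x2: "c < x2" "x2 < b" "l x2 * (- u1 x2) > M * K" using x2' by (auto simp: x2_def)
  have lam1: "u1 x1 > K" using large[of x1 "u1 x1"] x1 c by auto
  have lam2: "- u1 x2 > K" using large[of x2 "- u1 x2"] x2 c by auto
  define A where "A = (\<lambda>x. arctan (u1 x / (2 * \<kappa>)) / \<kappa> + integral {a..x} l)"
  have "A x1 \<le> A x2"
  proof (rule DERIV_nonneg_imp_nondecreasing[of x1 x2 A])
    show "x1 \<le> x2" using x1 x2 by simp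
    fix x assume "x1 \<le> x" "x \<le> x2"
    then have x: "a < x" "x < b" using x1 x2 by auto
    have "((\<lambda>x. integral {a..x} l) has_real_derivative l x) (at x within {a..b})"
      using integral_has_real_derivative[OF contl, of x] x by simp
    then have dint: "((\<lambda>x. integral {a..x} l) has_real_derivative l x) (at x)"
      using x by (simp add: at_within_Icc_at)
    have dA: "(A has_real_derivative
        (l x * u2 x / (2 * \<kappa>)) / (1 + (u1 x / (2 * \<kappa>))\<^sup>2) / \<kappa> + l x) (at x)"
      unfolding A_def using x \<open>\<kappa> > 0\<close>
      by (auto intro!: derivative_eq_intros der2 dint simp: divide_simps)
    have "(l x * u2 x / (2 * \<kappa>)) / (1 + (u1 x / (2 * \<kappa>))\<^sup>2) / \<kappa> + l x
        = l x * (u2 x / 2 + (u1 x)\<^sup>2 / 4 + \<kappa>\<^sup>2) / (\<kappa>\<^sup>2 + (u1 x)\<^sup>2 / 4)"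
    proof -
      define Q where "Q = \<kappa>\<^sup>2 + (u1 x)\<^sup>2 / 4"
      have "Q > 0" using \<open>\<kappa> > 0\<close> by (simp add: Q_def add_pos_nonneg)
      have 1: "1 + (u1 x / (2 * \<kappa>))\<^sup>2 = Q / \<kappa>\<^sup>2"
        using \<open>\<kappa> > 0\<close> by (simp add: Q_def field_simps)
      have 2: "u2 x / 2 + (u1 x)\<^sup>2 / 4 + \<kappa>\<^sup>2 = u2 x / 2 + Q" by (simp add: Q_def)
      show ?thesis
        unfolding 1 2 Q_def[symmetric]
        using \<open>\<kappa> > 0\<close> \<open>Q > 0\<close> by (simp add: field_simps power2_eq_square)
    qed
    also have "\<dots> \<ge> 0"
      using ineq[OF x] lpos[of x] x \<open>\<kappa> > 0\<close> by (intro divide_nonneg_nonneg mult_nonneg_nonneg) auto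
    finally show "\<exists>D. (A has_real_derivative D) (at x) \<and> D \<ge> 0" using dA by blast
  qed
  moreover have "A x1 \<ge> y / \<kappa>"
  proof -
    have "y \<le> arctan (u1 x1 / (2 * \<kappa>))"
      unfolding arctanK[symmetric] using lam1 \<open>\<kappa> > 0\<close> by (intro arctan_monotone') (simp add: divide_simps)
    moreover have "integral {a..x1} l \<ge> 0"
      using int[of a x1] lpos x1 c by (intro integral_nonneg) (auto simp: less_imp_le)
    ultimately show ?thesis
      using divide_right_mono[of y "arctan (u1 x1 / (2 * \<kappa>))" \<kappa>] \<open>\<kappa> > 0\<close>
      unfolding A_def by linarith
  qed
  moreover have "A x2 \<le> - y / \<kappa> + I"
  proof -
    have "arctan (u1 x2 / (2 * \<kappa>)) \<le> arctan (- (K / (2 * \<kappa>)))"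
      using lam2 \<open>\<kappa> > 0\<close> by (intro arctan_monotone') (simp add: divide_simps)
    then have "arctan (u1 x2 / (2 * \<kappa>)) \<le> - y"
      by (simp add: arctan_minus arctanK del: minus_divide_left)
    moreover have "integral {a..x2} l \<le> I"
      unfolding I_def using int[of a x2] int[of a b] lpos x2 c
      by (intro integral_subset_le) (auto simp: less_imp_le)
    ultimately show ?thesis
      using divide_right_mono[of "arctan (u1 x2 / (2 * \<kappa>))" "- y" \<kappa>] \<open>\<kappa> > 0\<close>
      unfolding A_def by linarith
  qed
  ultimately have "y / \<kappa> \<le> - y / \<kappa> + I" by linarith
  then show False using y \<open>\<kappa> > 0\<close> by (simp add: field_simps)
qed

section \<open>Geodesics of the comparison metric and their length\<close>

text \<open>
The geodesic equation of \<open>exp (2 * \<phi>) |dz|\<^sup>2\<close>, \<open>z'' = - 2 \<phi>_z z'\<^sup>2\<close> in arc length, written as a first order system for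
the position \<open>z\<close> and the unit velocity \<open>w\<close>. The parameter need not be the arc length, since the
geodesics constructed below come with another one; \<open>l\<close> is the density of arc length.
\<close>
definition geodesic_arc ::
  "real \<Rightarrow> real \<Rightarrow> real \<Rightarrow> (real \<Rightarrow> complex) \<Rightarrow> (real \<Rightarrow> complex) \<Rightarrow> (real \<Rightarrow> real) \<Rightarrow> bool" where
  "geodesic_arc t a b z w l \<longleftrightarrow> a < b \<and> continuous_on {a..b} l \<and>
    (\<forall>x\<in>{a..b}. l x > 0 \<and> z x \<in> ball 0 1 \<and> norm (w x) = (1 - (norm (z x))\<^sup>2) powr t \<and>
      (z has_vector_derivative of_real (l x) * w x) (at x within {a..b}) \<and>
      (w has_vector_derivative of_real (l x) * (- 2 * phi_z t (z x) * (w x)\<^sup>2)) (at x within {a..b}))"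

lemma geodesic_arcD:
  assumes "geodesic_arc t a b z w l"
  shows "a < b" "continuous_on {a..b} l"
    and "\<And>x. x \<in> {a..b} \<Longrightarrow> l x > 0" "\<And>x. x \<in> {a..b} \<Longrightarrow> z x \<in> ball 0 1"
    and "\<And>x. x \<in> {a..b} \<Longrightarrow> norm (w x) = (1 - (norm (z x))\<^sup>2) powr t"
    and "\<And>x. x \<in> {a..b} \<Longrightarrow> (z has_vector_derivative of_real (l x) * w x) (at x within {a..b})"
    and "\<And>x. x \<in> {a..b} \<Longrightarrow>
      (w has_vector_derivative of_real (l x) * (- 2 * phi_z t (z x) * (w x)\<^sup>2)) (at x within {a..b})"
  using assms unfolding geodesic_arc_def by blast+

text \<open>
The substitution \<open>x = 2 s - 1\<close> turns the integral into the Beta integral with both arguments \<open>1 - t\<close>, to which the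
duplication formula of the Gamma function applies.
\<close>
lemma diameter_length:
  fixes t :: real
  assumes t: "t < 1"
  shows "((\<lambda>x. (1 - x\<^sup>2) powr - t) has_integral sqrt pi * Gamma (1 - t) / Gamma (3 / 2 - t)) {-1..1}"
proof -
  have "((\<lambda>x. x powr (1 - t - 1) * (1 - x) powr (1 - t - 1)) has_integral Beta (1 - t) (1 - t)) (cbox 0 1)"
    using has_integral_Beta_real[of "1 - t" "1 - t"] t by simp
  from has_integral_affinity'[OF this, of "1 / 2" "1 / 2"]
  have "((\<lambda>x. (1 / 2 * x + 1 / 2) powr - t * (1 - (1 / 2 * x + 1 / 2)) powr - t)
          has_integral 2 * Beta (1 - t) (1 - t)) {-1..1}"
    by simp
  then have "((\<lambda>x. (1 / 4) powr t * ((1 / 2 * x + 1 / 2) powr - t * (1 - (1 / 2 * x + 1 / 2)) powr - t))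
          has_integral (1 / 4) powr t * (2 * Beta (1 - t) (1 - t))) {-1..1}"
    by (rule has_integral_mult_right)
  then have "((\<lambda>x. (1 - x\<^sup>2) powr - t) has_integral (1 / 4) powr t * (2 * Beta (1 - t) (1 - t))) {-1..1}"
  proof (rule has_integral_eq[rotated])
    fix x :: real assume x: "x \<in> {-1..1}"
    have "(1 / 2 * x + 1 / 2) powr - t * (1 - (1 / 2 * x + 1 / 2)) powr - t
        = ((1 / 2 * x + 1 / 2) * (1 - (1 / 2 * x + 1 / 2))) powr - t"
      by (simp only: powr_mult)
    also have "(1 / 2 * x + 1 / 2) * (1 - (1 / 2 * x + 1 / 2)) = (1 / 4) * (1 - x\<^sup>2)"
      by (simp add: field_simps power2_eq_square)
    also have "\<dots> powr - t = (1 / 4) powr - t * (1 - x\<^sup>2) powr - t"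
      by (rule powr_mult)
    finally show "(1 / 4) powr t * ((1 / 2 * x + 1 / 2) powr - t * (1 - (1 / 2 * x + 1 / 2)) powr - t)
        = (1 - x\<^sup>2) powr - t"
      by (simp add: powr_minus)
  qed
  also have "(1 / 4) powr t * (2 * Beta (1 - t) (1 - t)) = sqrt pi * Gamma (1 - t) / Gamma (3 / 2 - t)"
  proof -
    have nonpos: "complex_of_real s \<notin> \<int>\<^sub>\<le>\<^sub>0" if "s > 0" for s
      using that by (auto elim!: nonpos_Ints_cases simp: complex_eq_iff)
    have nonpos: "1 - complex_of_real t \<notin> \<int>\<^sub>\<le>\<^sub>0" "3 / 2 - complex_of_real t \<notin> \<int>\<^sub>\<le>\<^sub>0"
      using nonpos[of "1 - t"] nonpos[of "3 / 2 - t"] t by auto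
    have "complex_of_real (Gamma (1 - t) * Gamma (3 / 2 - t))
        = of_real (exp ((2 * t - 1) * ln 2) * sqrt pi * Gamma (2 - 2 * t))"
      using Gamma_legendre_duplication[of "of_real (1 - t)"] nonpos
      by (simp add: Gamma_complex_of_real[symmetric] exp_of_real[symmetric] algebra_simps)
    then have dup: "Gamma (1 - t) * Gamma (3 / 2 - t) = 2 powr (2 * t - 1) * sqrt pi * Gamma (2 - 2 * t)"
      unfolding of_real_eq_iff by (simp add: powr_def)
    have pos: "Gamma (1 - t) > 0" "Gamma (3 / 2 - t) > 0" "Gamma (2 - 2 * t) > 0"
      using t by (auto intro!: Gamma_real_pos)
    have p: "(1 / 4) powr t * 2 * 2 powr (2 * t - 1) = (1::real)"
    proof -
      have "(1 / 4 :: real) powr t = 2 powr (- 2 * t)"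
        by (simp add: powr_def ln_div ln_realpow[of 2 2, simplified])
      then have "(1 / 4 :: real) powr t * 2 powr 1 * 2 powr (2 * t - 1) = 2 powr (- 2 * t + 1 + (2 * t - 1))"
        by (simp only: powr_add)
      then show ?thesis by simp
    qed
    have "(1 / 4) powr t * (2 * Beta (1 - t) (1 - t)) * Gamma (3 / 2 - t)
        = (1 / 4) powr t * 2 * Gamma (1 - t) * (Gamma (1 - t) * Gamma (3 / 2 - t)) / Gamma (2 - 2 * t)"
      by (simp add: Beta_def)
    also have "\<dots> = ((1 / 4) powr t * 2 * 2 powr (2 * t - 1)) * sqrt pi * Gamma (1 - t)"
      unfolding dup using pos by simp
    finally show ?thesis unfolding p using pos by (simp add: field_simps)
  qed
  finally show ?thesis .
qed

lemma concave_Bernoulli_inequality: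
  fixes t x :: real
  assumes "0 \<le> t" "t \<le> 1" "0 \<le> x"
  shows "(1 + x) powr t \<le> 1 + t * x"
proof -
  have "1 + t * 0 - (1 + 0) powr t \<le> 1 + t * x - (1 + x) powr t"
  proof (rule DERIV_nonneg_imp_nondecreasing[of 0 x "\<lambda>x. 1 + t * x - (1 + x) powr t"])
    fix y :: real assume "0 \<le> y" "y \<le> x"
    then have "((\<lambda>x. 1 + t * x - (1 + x) powr t) has_real_derivative t - t * (1 + y) powr (t - 1)) (at y)"
      by (auto intro!: derivative_eq_intros)
    moreover have "(1 + y) powr (t - 1) \<le> 1"
      using powr_mono[of "t - 1" 0 "1 + y"] assms \<open>0 \<le> y\<close> by simp
    then have "t - t * (1 + y) powr (t - 1) \<ge> 0"
      using assms mult_left_mono[of "(1 + y) powr (t - 1)" 1 t] by simp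
    ultimately show "\<exists>D. ((\<lambda>x. 1 + t * x - (1 + x) powr t) has_real_derivative D) (at y) \<and> D \<ge> 0"
      by blast
  qed (use assms in auto)
  then show ?thesis by simp
qed

text \<open>
The function \<open>J = |z| cos \<psi>\<close>, where \<open>\<psi>\<close> is the angle between the velocity and the radial direction, takes values
in the interval from \<open>- 1\<close> to \<open>1\<close>. For \<open>t = 0\<close> it is the position on a straight line, measured from the point next to
the origin. In general it grows so fast that \<open>(1 - J\<^sup>2) powr - t\<close> times the derivative of \<open>J\<close> dominates the arc length
element; with \<open>X = |z|\<^sup>2 sin\<^sup>2 \<psi> / (1 - |z|\<^sup>2)\<close> this amounts to \<open>(1 + X) powr t \<le> 1 + 2 * t * X\<close>. Hence the
geodesic is not longer than the piece of a diameter between the values of \<open>J\<close> at its ends.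
\<close>
lemma geodesic_arc_length:
  assumes geo: "geodesic_arc t a b z w l" and t: "0 \<le> t" "t < 1"
  shows "integral {a..b} l < sqrt pi * Gamma (1 - t) / Gamma (3 / 2 - t)"
proof -
  note g = geodesic_arcD[OF geo]
  define J where "J = (\<lambda>x. Re (cnj (z x) * w x) * (1 - (norm (z x))\<^sup>2) powr - t)"
  define J' where "J' = (\<lambda>x. (1 - (norm (z x))\<^sup>2) powr - t * ((norm (w x))\<^sup>2
       + 2 * t * (Im (cnj (z x) * w x))\<^sup>2 / (1 - (norm (z x))\<^sup>2)))"
  have J_bound: "\<bar>J x\<bar> \<le> norm (z x)" if "x \<in> {a..b}" for x
  proof -
    have d: "1 - (norm (z x))\<^sup>2 > 0" by (rule one_minus_norm_square_pos[OF g(4)[OF that]])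
    have "\<bar>Re (cnj (z x) * w x)\<bar> \<le> norm (z x) * norm (w x)"
      by (metis abs_Re_le_cmod complex_mod_cnj norm_mult)
    then have "\<bar>J x\<bar> \<le> norm (z x) * norm (w x) * (1 - (norm (z x))\<^sup>2) powr - t"
      by (simp add: J_def abs_mult mult_right_mono)
    also have "\<dots> = norm (z x)"
      using d by (simp add: g(5)[OF that] powr_minus)
    finally show ?thesis .
  qed
  have J_deriv: "(J has_real_derivative l x * J' x) (at x within {a..b})" if x: "x \<in> {a..b}" for x
  proof -
    define d where "d = 1 - (norm (z x))\<^sup>2"
    have d: "d > 0" unfolding d_def by (rule one_minus_norm_square_pos[OF g(4)[OF that]])
    have dz: "(z has_derivative (\<lambda>y. y *\<^sub>R (of_real (l x) * w x))) (at x within {a..b})"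
      using g(6)[OF x] by (simp add: has_vector_derivative_def)
    have dw: "(w has_derivative (\<lambda>y. y *\<^sub>R (of_real (l x) * (- 2 * phi_z t (z x) * (w x)\<^sup>2)))) (at x within {a..b})"
      using g(7)[OF x] by (simp add: has_vector_derivative_def)
    have 1: "((\<lambda>x. Re (cnj (z x) * w x)) has_real_derivative
        l x * ((norm (w x))\<^sup>2 - 2 * t * Re ((cnj (z x) * w x)\<^sup>2) / d)) (at x within {a..b})"
    proof -
      have "((\<lambda>x. Re (cnj (z x) * w x)) has_derivative
        (\<lambda>y. Re (cnj (z x) * (y *\<^sub>R (of_real (l x) * (- 2 * phi_z t (z x) * (w x)\<^sup>2)))
              + cnj (y *\<^sub>R (of_real (l x) * w x)) * w x))) (at x within {a..b})"
        by (intro bounded_linear.has_derivative[OF bounded_linear_Re] has_derivative_mult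
             has_derivative_cnj_compose dz dw)
      moreover have "Re (cnj (z x) * (y *\<^sub>R (of_real (l x) * (- 2 * phi_z t (z x) * (w x)\<^sup>2)))
              + cnj (y *\<^sub>R (of_real (l x) * w x)) * w x)
          = l x * ((norm (w x))\<^sup>2 - 2 * t * Re ((cnj (z x) * w x)\<^sup>2) / d) * y" for y
      proof -
        have "cnj (z x) * (y *\<^sub>R (of_real (l x) * (- 2 * phi_z t (z x) * (w x)\<^sup>2)))
              + cnj (y *\<^sub>R (of_real (l x) * w x)) * w x
            = of_real (l x * y) * (of_real ((norm (w x))\<^sup>2) - of_real (2 * t / d) * (cnj (z x) * w x)\<^sup>2)"
          unfolding complex_norm_square phi_z_def d_def[symmetric]
          by (simp add: scaleR_conv_of_real power2_eq_square algebra_simps)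
        moreover have "Re (of_real (l x * y) * (of_real ((norm (w x))\<^sup>2) - of_real (2 * t / d) * Z))
            = l x * ((norm (w x))\<^sup>2 - 2 * t * Re Z / d) * y" for Z
          unfolding Re_complex_of_real times_complex.sel minus_complex.sel Im_complex_of_real
          by (simp add: algebra_simps)
        ultimately show ?thesis by (simp only:)
      qed
      ultimately show ?thesis by (simp add: has_field_derivative_def)
    qed
    have 2: "((\<lambda>x. 1 - (norm (z x))\<^sup>2) has_real_derivative l x * (- 2 * Re (cnj (z x) * w x))) (at x within {a..b})"
      unfolding has_field_derivative_def
      by (rule has_derivative_eq_rhs[OF has_derivative_compose[OF dz one_minus_norm_square_has_derivative]])
         (simp add: fun_eq_iff algebra_simps)
    have 3: "((\<lambda>x. (1 - (norm (z x))\<^sup>2) powr - t) has_real_derivative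
        (- t * d powr (- t - 1)) * (l x * (- 2 * Re (cnj (z x) * w x)))) (at x within {a..b})"
      unfolding d_def by (rule DERIV_chain2[OF has_real_derivative_powr[OF d[unfolded d_def]] 2])
    have J0: "(J has_real_derivative l x * ((norm (w x))\<^sup>2 - 2 * t * Re ((cnj (z x) * w x)\<^sup>2) / d) * d powr - t
       + (- t * d powr (- t - 1)) * (l x * (- 2 * Re (cnj (z x) * w x))) * Re (cnj (z x) * w x)) (at x within {a..b})"
      unfolding J_def using DERIV_mult'[OF 1 3] by (simp add: d_def algebra_simps)
    have 4: "d powr (- t - 1) = d powr - t / d" using d by (simp add: powr_diff)
    have 5: "Re ((cnj (z x) * w x)\<^sup>2) = (Re (cnj (z x) * w x))\<^sup>2 - (Im (cnj (z x) * w x))\<^sup>2"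
      by (rule Re_power2)
    have "l x * (n - 2 * t * (A\<^sup>2 - B\<^sup>2) / d) * p + (- t * (p / d)) * (l x * (- 2 * A)) * A
        = l x * (p * (n + 2 * t * B\<^sup>2 / d))" for A B n p :: real
      using d by (simp add: field_simps power2_eq_square)
    then show ?thesis
      using J0 unfolding J'_def d_def[symmetric] 4 5 by (simp only:)
  qed
  have J'_ge: "(1 - (J x)\<^sup>2) powr - t * J' x \<ge> 1" if x: "x \<in> {a..b}" for x
  proof -
    define d where "d = 1 - (norm (z x))\<^sup>2"
    have d: "d > 0" unfolding d_def by (rule one_minus_norm_square_pos[OF g(4)[OF that]])
    define y where "y = Im (cnj (z x) * w x) * d powr - t"
    define X where "X = y\<^sup>2 / d"
    have X0: "X \<ge> 0" using d by (simp add: X_def)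
    have nw: "norm (w x) = d powr t" by (simp add: g(5)[OF x] d_def)
    have "(J x)\<^sup>2 + y\<^sup>2 = (norm (cnj (z x) * w x))\<^sup>2 * (d powr - t)\<^sup>2"
      by (simp only: cmod_power2 J_def y_def d_def power_mult_distrib distrib_right)
    also have "\<dots> = (norm (z x))\<^sup>2"
      using d by (simp add: norm_mult nw power_mult_distrib powr_minus flip: power_mult_distrib)
    finally have "1 - (J x)\<^sup>2 = d + y\<^sup>2" by (simp add: d_def)
    also have "\<dots> = d * (1 + X)" using d by (simp add: X_def distrib_left)
    finally have e1: "(1 - (J x)\<^sup>2) powr - t = d powr - t * (1 + X) powr - t"
      using d X0 by (simp add: powr_mult)
    have yy: "Im (cnj (z x) * w x) = y * d powr t"
      using d by (simp add: y_def powr_minus)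
    have e2: "J' x = d powr t * (1 + 2 * t * X)"
      unfolding J'_def d_def[symmetric] yy nw X_def using d
      by (simp add: field_simps power2_eq_square powr_minus)
    have "(1 + X) powr t \<le> 1 + t * X"
      using t X0 by (intro concave_Bernoulli_inequality) auto
    also have "\<dots> \<le> 1 + 2 * t * X" using t X0 by simp
    finally have "(1 + X) powr t \<le> 1 + 2 * t * X" .
    then have "1 \<le> (1 + X) powr - t * (1 + 2 * t * X)"
      using X0 by (simp add: powr_minus field_simps)
    moreover have "d powr - t * A * (d powr t * B) = A * B" for A B
      using d by (simp add: powr_minus)
    ultimately show ?thesis unfolding e1 e2 by (simp only:)
  qed
  have contz: "continuous_on {a..b} z"
    using g(6) by (rule continuous_on_vector_derivative)
  obtain x0 where "x0 \<in> {a..b}" and x0: "\<And>x. x \<in> {a..b} \<Longrightarrow> norm (z x) \<le> norm (z x0)"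
    using continuous_attains_sup[of "{a..b}" "\<lambda>x. norm (z x)"] continuous_on_norm[OF contz] g(1)
    by fastforce
  define \<rho> where "\<rho> = norm (z x0)"
  have \<rho>: "0 \<le> \<rho>" "\<rho> < 1" using g(4)[OF \<open>x0 \<in> {a..b}\<close>] by (auto simp: \<rho>_def)
  have J_in: "J x \<in> {-\<rho>..\<rho>}" if "x \<in> {a..b}" for x
    using J_bound[OF that] x0[OF that] by (auto simp: \<rho>_def)
  define k where "k = (\<lambda>s::real. (1 - s\<^sup>2) powr - t)"
  have contk: "continuous_on {-s..s} k" if "s < 1" for s
  proof -
    have "1 - x\<^sup>2 \<noteq> 0" if "x \<in> {-s..s}" for x
    proof -
      have "\<bar>x\<bar> < 1" using that \<open>s < 1\<close> by auto
      then have "x\<^sup>2 < 1" by (simp add: abs_square_less_1)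
      then show ?thesis by simp
    qed
    then show ?thesis unfolding k_def by (intro continuous_intros) auto
  qed
  define H where "H = (\<lambda>s. integral {-\<rho>..s} k)"
  have dH: "(H has_real_derivative k s) (at s within {-\<rho>..\<rho>})" if "s \<in> {-\<rho>..\<rho>}" for s
    unfolding H_def using integral_has_real_derivative[OF contk[OF \<rho>(2)] that] .
  have dHJ: "((\<lambda>x. H (J x)) has_real_derivative k (J x) * (l x * J' x)) (at x within {a..b})" if x: "x \<in> {a..b}" for x
  proof -
    have "J ` {a..b} \<subseteq> {-\<rho>..\<rho>}" using J_in by auto
    then have "(H has_real_derivative k (J x)) (at (J x) within J ` {a..b})"
      using dH[OF J_in[OF x]] by (rule DERIV_subset[rotated])
    from DERIV_image_chain[OF this J_deriv[OF x]] show ?thesis by (simp add: o_def)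
  qed
  have I1: "((\<lambda>x. k (J x) * (l x * J' x)) has_integral H (J b) - H (J a)) {a..b}"
    using g(1) dHJ
    by (intro fundamental_theorem_of_calculus) (auto simp: has_real_derivative_iff_has_vector_derivative)
  have I2: "(l has_integral integral {a..b} l) {a..b}"
    using g(2) by (simp add: integrable_continuous_real integrable_integral)
  have "integral {a..b} l \<le> H (J b) - H (J a)"
  proof (rule has_integral_le[OF I2 I1])
    fix x assume x: "x \<in> {a..b}"
    have "l x * 1 \<le> l x * (k (J x) * J' x)"
      using g(3)[OF x] J'_ge[OF x] by (intro mult_left_mono) (auto simp: k_def)
    then show "l x \<le> k (J x) * (l x * J' x)" by (simp add: algebra_simps)
  qed
  also have "\<dots> \<le> integral {-\<rho>..\<rho>} k"
  proof -
    have int: "k integrable_on {-\<rho>..\<rho>}"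
      using contk[OF \<rho>(2)] by (rule integrable_continuous_real)
    have nn: "0 \<le> k s" for s by (simp add: k_def)
    have "H (J b) \<le> integral {-\<rho>..\<rho>} k"
      unfolding H_def using J_in[of b] g(1) nn int
      by (intro integral_subset_le) (auto intro: integrable_subinterval_real[OF int])
    moreover have "H (J a) \<ge> 0" unfolding H_def using J_in[of a] g(1) nn
      by (intro integral_nonneg integrable_subinterval_real[OF int]) auto
    ultimately show ?thesis by simp
  qed
  also have "\<dots> < integral {-1..1} k"
  proof -
    have int: "k integrable_on {-1..1}" 
      using diameter_length[OF t(2)] unfolding k_def by blast
    have sub: "k integrable_on {x..y}" if "-1 \<le> x" "y \<le> 1" for x y
      using that by (intro integrable_subinterval_real[OF int]) auto
    define m where "m = (1 + \<rho>) / 2"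
    have m: "\<rho> < m" "m < 1" using \<rho> by (auto simp: m_def)
    have "integral {-\<rho>..\<rho>} k + integral {\<rho>..m} k = integral {-\<rho>..m} k"
      using m \<rho> by (intro Henstock_Kurzweil_Integration.integral_combine sub) auto
    moreover have "integral {-\<rho>..m} k \<le> integral {-1..1} k"
      using m \<rho> by (intro integral_subset_le sub) (auto simp: k_def)
    moreover have "integral {\<rho>..m} (\<lambda>x. 1) \<le> integral {\<rho>..m} k"
    proof (rule integral_le)
      fix s assume s: "s \<in> {\<rho>..m}"
      then have "0 < 1 - s\<^sup>2" "1 - s\<^sup>2 \<le> 1" using \<rho> m by (auto simp: abs_square_less_1)
      then show "1 \<le> k s" unfolding k_def using t
        by (simp add: powr_minus powr_le1 one_le_inverse)
    qed (use sub m \<rho> in auto)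
    ultimately show ?thesis using m by simp
  qed
  also have "\<dots> = sqrt pi * Gamma (1 - t) / Gamma (3 / 2 - t)"
    using diameter_length[OF t(2)] unfolding k_def by (rule integral_unique)
  finally show ?thesis .
qed

section \<open>Existence of geodesics between two points\<close>

lemma geodesic_arc_diameter:
  assumes u: "norm u = 1" and xy: "-1 < x" "x < y" "y < 1"
  shows "geodesic_arc t x y (\<lambda>s. of_real s * u) (\<lambda>s. of_real ((1 - s\<^sup>2) powr t) * u) (\<lambda>s. (1 - s\<^sup>2) powr - t)"
  unfolding geodesic_arc_def
proof (intro conjI ballI)
  have d: "1 - s\<^sup>2 > 0" if "s \<in> {x..y}" for s
  proof -
    have "\<bar>s\<bar> < 1" using that xy by auto
    then show ?thesis by (simp add: abs_square_less_1)
  qed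
  show "x < y" by fact
  show "continuous_on {x..y} (\<lambda>s. (1 - s\<^sup>2) powr - t)"
    using d by (intro continuous_intros) force
  fix s assume s: "s \<in> {x..y}"
  note ds = d[OF s]
  show "(1 - s\<^sup>2) powr - t > 0" using ds by simp
  show "of_real s * u \<in> ball 0 1"
    using s xy u by (auto simp: norm_mult)
  show "norm (of_real ((1 - s\<^sup>2) powr t) * u) = (1 - (norm (of_real s * u))\<^sup>2) powr t"
    using u by (simp add: norm_mult)
  have "((\<lambda>s. of_real s * u) has_vector_derivative u) (at s within {x..y})"
    by (auto intro!: derivative_eq_intros)
  then show "((\<lambda>s. of_real s * u) has_vector_derivative
      of_real ((1 - s\<^sup>2) powr - t) * (of_real ((1 - s\<^sup>2) powr t) * u)) (at s within {x..y})"
    using ds by (simp add: powr_minus flip: mult.assoc)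
  have "((\<lambda>s. (1 - s\<^sup>2) powr t) has_real_derivative t * (1 - s\<^sup>2) powr (t - 1) * (- 2 * s)) (at s within {x..y})"
    using ds by (auto intro!: derivative_eq_intros)
  then have "((\<lambda>s. of_real ((1 - s\<^sup>2) powr t) * u) has_vector_derivative
      of_real (t * (1 - s\<^sup>2) powr (t - 1) * (- 2 * s)) * u) (at s within {x..y})"
    by (intro has_vector_derivative_mult_left has_vector_derivative_of_real)
  moreover have "of_real (t * (1 - s\<^sup>2) powr (t - 1) * (- 2 * s)) * u
     = of_real ((1 - s\<^sup>2) powr - t) * (- 2 * phi_z t (of_real s * u) * (of_real ((1 - s\<^sup>2) powr t) * u)\<^sup>2)"
  proof -
    have "(1 - s\<^sup>2) powr (t - 1) = (1 - s\<^sup>2) powr t / (1 - s\<^sup>2)" using ds by (simp add: powr_diff)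
    moreover have "cnj u * u\<^sup>2 = u"
      using u complex_norm_square[of u] by (simp add: power2_eq_square mult.commute flip: mult.assoc)
    moreover have "of_real ((1 - s\<^sup>2) powr - t) * (- 2 * phi_z t (of_real s * u) * (of_real ((1 - s\<^sup>2) powr t) * u)\<^sup>2)
       = - of_real (2 * t * s * ((1 - s\<^sup>2) powr - t * (1 - s\<^sup>2) powr t) * (1 - s\<^sup>2) powr t / (1 - s\<^sup>2)) * (cnj u * u\<^sup>2)"
      using u by (simp add: phi_z_def norm_mult power_mult_distrib power2_eq_square)
    moreover have "(1 - s\<^sup>2) powr - t * (1 - s\<^sup>2) powr t = 1" using ds by (simp add: powr_minus)
    ultimately show ?thesis by simp
  qed
  ultimately show "((\<lambda>s. of_real ((1 - s\<^sup>2) powr t) * u) has_vector_derivative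
     of_real ((1 - s\<^sup>2) powr - t) * (- 2 * phi_z t (of_real s * u) * (of_real ((1 - s\<^sup>2) powr t) * u)\<^sup>2)) (at s within {x..y})"
    by (simp only:)
qed

lemma geodesic_arc_cnj:
  assumes "geodesic_arc t a b z w l"
  shows "geodesic_arc t a b (\<lambda>x. cnj (z x)) (\<lambda>x. cnj (w x)) l"
proof -
  note g = geodesic_arcD[OF assms]
  have c: "((\<lambda>x. cnj (f x)) has_vector_derivative cnj f') F" if "(f has_vector_derivative f') F" for f f' F
    using has_derivative_cnj_compose[OF that[unfolded has_vector_derivative_def]]
    by (simp add: has_vector_derivative_def)
  have "cnj (phi_z t (z x)) = phi_z t (cnj (z x))" for x
    by (simp add: phi_z_def)
  then show ?thesis
    unfolding geodesic_arc_def using g c[OF g(6)] c[OF g(7)] by simp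
qed

text \<open>
Clairaut's relation: along a geodesic of the rotationally symmetric metric, \<open>clairaut t r * sin \<psi>\<close> is
constant, where \<open>r\<close> is the distance from the origin and \<open>\<psi>\<close> the angle between the velocity and the radial direction.
\<close>
definition clairaut :: "real \<Rightarrow> real \<Rightarrow> real" where
  "clairaut t r = r * (1 - r\<^sup>2) powr - t"

text \<open>
The logarithmic derivative \<open>r m'(r) / m(r)\<close> of \<open>m = clairaut t\<close>.
\<close>
definition clairaut_slope :: "real \<Rightarrow> real \<Rightarrow> real" where
  "clairaut_slope t r = 1 + 2 * t * r\<^sup>2 / (1 - r\<^sup>2)"

text \<open>
The parameter \<open>x\<close> is \<open>\<pi> - \<psi>\<close>, where \<open>\<psi>\<close> is the angle between the velocity and the radial direction. In contrast
to \<open>r\<close> it is monotone along the whole geodesic, which approaches the origin for \<open>x < \<pi> / 2\<close> and recedes from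
it for \<open>x > \<pi> / 2\<close>, and the polar angle \<open>\<theta>\<close> becomes an integral without singularity at the turning point.
Differentiating Clairaut's relation logarithmically gives the equation for \<open>r\<close>; the equation for
\<open>\<theta>\<close> follows from \<open>r \<theta>' = - tan x r'\<close>.
\<close>
lemma geodesic_arc_of_clairaut:
  assumes u: "norm u = 1" and ab: "0 < a" "a < b" "b < pi" and t: "t \<ge> 0"
    and r01: "\<And>x. x \<in> {a..b} \<Longrightarrow> 0 < r x \<and> r x < 1"
    and dr: "\<And>x. x \<in> {a..b} \<Longrightarrow> (r has_real_derivative
        - (r x * cos x / (clairaut_slope t (r x) * sin x))) (at x within {a..b})"
    and d\<theta>: "\<And>x. x \<in> {a..b} \<Longrightarrow> (\<theta> has_real_derivative 1 / clairaut_slope t (r x)) (at x within {a..b})"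
  shows "geodesic_arc t a b (\<lambda>x. of_real (r x) * (u * cis (\<theta> x)))
     (\<lambda>x. - of_real ((1 - (r x)\<^sup>2) powr t) * (u * cis (\<theta> x - x)))
     (\<lambda>x. r x / (clairaut_slope t (r x) * sin x) * (1 - (r x)\<^sup>2) powr - t)"
  unfolding geodesic_arc_def
proof (intro conjI ballI)
  have d: "1 - (r x)\<^sup>2 > 0" if "x \<in> {a..b}" for x
    using r01[OF that] by (simp add: abs_square_less_1)
  have N: "clairaut_slope t (r x) > 0" if "x \<in> {a..b}" for x
    using d[OF that] t unfolding clairaut_slope_def by (intro add_pos_nonneg divide_nonneg_pos) auto
  have sin: "sin x > 0" if "x \<in> {a..b}" for x
    using that ab by (intro sin_gt_zero) auto
  show "a < b" by fact
  have contr: "continuous_on {a..b} r"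
    using dr by (meson DERIV_continuous continuous_on_eq_continuous_within)
  then have contN: "continuous_on {a..b} (\<lambda>x. clairaut_slope t (r x))"
    unfolding clairaut_slope_def using d by (intro continuous_intros) force+
  show "continuous_on {a..b} (\<lambda>x. r x / (clairaut_slope t (r x) * sin x) * (1 - (r x)\<^sup>2) powr - t)"
    using contr contN sin N d by (intro continuous_intros) force+
  fix x assume x: "x \<in> {a..b}"
  note dx = d[OF x] and Nx = N[OF x] and sx = sin[OF x]
  define R where "R = r x"
  define D where "D = 1 - R\<^sup>2"
  define n where "n = clairaut_slope t R"
  define v where "v = u * cis (\<theta> x)"
  have D: "D > 0" and n: "n > 0" using dx Nx by (simp_all add: D_def R_def n_def)
  have nv: "norm v = 1" using u by (simp add: v_def norm_mult)
  show "r x / (clairaut_slope t (r x) * sin x) * (1 - (r x)\<^sup>2) powr - t > 0"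
    using r01[OF x] Nx sx dx by simp
  show "of_real (r x) * (u * cis (\<theta> x)) \<in> ball 0 1"
    using nv r01[OF x] by (simp add: norm_mult v_def)
  show "norm (- of_real ((1 - (r x)\<^sup>2) powr t) * (u * cis (\<theta> x - x)))
      = (1 - (norm (of_real (r x) * (u * cis (\<theta> x))))\<^sup>2) powr t"
    using u by (simp add: norm_mult)
  have dcis: "((\<lambda>x. u * cis (\<eta> x)) has_vector_derivative of_real \<eta>' * (\<i> * (u * cis (\<eta> x)))) (at x within {a..b})"
    if "(\<eta> has_real_derivative \<eta>') (at x within {a..b})" for \<eta> \<eta>'
    unfolding has_vector_derivative_def
    by (rule has_derivative_eq_rhs[OF has_derivative_mult_right[OF has_derivative_cis[OF that[unfolded has_field_derivative_def]]]])
       (simp add: fun_eq_iff scaleR_conv_of_real algebra_simps)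
  have cis_x: "cis (\<theta> x - x) = cis (\<theta> x) * (of_real (cos x) - \<i> * of_real (sin x))"
    by (simp add: complex_eq_iff cos_diff sin_diff algebra_simps)
  have "((\<lambda>x. of_real (r x) * (u * cis (\<theta> x))) has_vector_derivative
      of_real (r x) * (of_real (1 / clairaut_slope t (r x)) * (\<i> * (u * cis (\<theta> x))))
      + of_real (- (r x * cos x / (clairaut_slope t (r x) * sin x))) * (u * cis (\<theta> x))) (at x within {a..b})"
    by (intro has_vector_derivative_mult has_vector_derivative_of_real dr dcis d\<theta> x)
  moreover have "of_real (r x) * (of_real (1 / clairaut_slope t (r x)) * (\<i> * (u * cis (\<theta> x))))
      + of_real (- (r x * cos x / (clairaut_slope t (r x) * sin x))) * (u * cis (\<theta> x))
     = of_real (r x / (clairaut_slope t (r x) * sin x) * (1 - (r x)\<^sup>2) powr - t)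
        * (- of_real ((1 - (r x)\<^sup>2) powr t) * (u * cis (\<theta> x - x)))"
  proof -
    have p: "D powr - t * D powr t = 1" using D by (simp add: powr_minus)
    have "of_real (R / (n * sin x) * D powr - t) * (- of_real (D powr t) * (u * cis (\<theta> x - x)))
        = - of_real (R / (n * sin x) * (D powr - t * D powr t)) * (u * cis (\<theta> x - x))"
      by simp
    also have "\<dots> = - of_real (R / (n * sin x)) * (v * (of_real (cos x) - \<i> * of_real (sin x)))"
      unfolding p cis_x v_def by simp
    also have "\<dots> = of_real R * (of_real (1 / n) * (\<i> * v)) + of_real (- (R * cos x / (n * sin x))) * v"
      using n sx by (simp add: field_simps)
    finally show ?thesis unfolding R_def[symmetric] D_def[symmetric] n_def[symmetric] v_def[symmetric] by (rule sym)
  qed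
  ultimately show "((\<lambda>x. of_real (r x) * (u * cis (\<theta> x))) has_vector_derivative
      of_real (r x / (clairaut_slope t (r x) * sin x) * (1 - (r x)\<^sup>2) powr - t)
        * (- of_real ((1 - (r x)\<^sup>2) powr t) * (u * cis (\<theta> x - x)))) (at x within {a..b})"
    by (simp only:)
  define w where "w = - of_real (D powr t) * (u * cis (\<theta> x - x))"
  have "((\<lambda>x. (1 - (r x)\<^sup>2) powr t) has_real_derivative
       t * (1 - (r x)\<^sup>2) powr (t - 1) * (- 2 * r x * - (r x * cos x / (clairaut_slope t (r x) * sin x)))) (at x within {a..b})"
    using dx by (auto intro!: derivative_eq_intros dr[OF x])
  moreover have "t * (1 - (r x)\<^sup>2) powr (t - 1) * (- 2 * r x * - (r x * cos x / (clairaut_slope t (r x) * sin x)))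
      = D powr t * (2 * t * R\<^sup>2 * cos x / (n * D * sin x))"
  proof -
    have "D powr (t - 1) = D powr t / D" using D by (simp add: powr_diff)
    then show ?thesis
      unfolding R_def[symmetric] n_def[symmetric] D_def[symmetric] by (simp add: power2_eq_square mult_ac)
  qed
  ultimately have dp: "((\<lambda>x. - ((1 - (r x)\<^sup>2) powr t)) has_real_derivative
       - (D powr t * (2 * t * R\<^sup>2 * cos x / (n * D * sin x)))) (at x within {a..b})"
    by (intro DERIV_minus) (simp only:)
  have "((\<lambda>x. of_real (- ((1 - (r x)\<^sup>2) powr t)) * (u * cis (\<theta> x - x))) has_vector_derivative
      of_real (- ((1 - (r x)\<^sup>2) powr t)) * (of_real (1 / clairaut_slope t (r x) - 1) * (\<i> * (u * cis (\<theta> x - x))))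
      + of_real (- (D powr t * (2 * t * R\<^sup>2 * cos x / (n * D * sin x)))) * (u * cis (\<theta> x - x))) (at x within {a..b})"
    by (intro has_vector_derivative_mult has_vector_derivative_of_real dp dcis DERIV_diff d\<theta> x DERIV_ident)
  moreover have "of_real (- ((1 - (r x)\<^sup>2) powr t)) * (of_real (1 / clairaut_slope t (r x) - 1) * (\<i> * (u * cis (\<theta> x - x))))
      + of_real (- (D powr t * (2 * t * R\<^sup>2 * cos x / (n * D * sin x)))) * (u * cis (\<theta> x - x))
     = of_real (R / (n * sin x) * D powr - t) * (- 2 * phi_z t (of_real R * v) * w\<^sup>2)"
  proof -
    have p: "D powr - t * D powr t = 1" using D by (simp add: powr_minus)
    have n1: "1 / n - 1 = - (2 * t * R\<^sup>2 / (n * D))"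
    proof -
      have "1 - n = - (2 * t * R\<^sup>2 / D)" by (simp add: n_def clairaut_slope_def D_def)
      moreover have "1 / n - 1 = (1 - n) / n" using n by (simp add: diff_divide_distrib)
      ultimately show ?thesis by (simp add: mult.commute)
    qed
    have vv: "cnj v * v = 1" using nv complex_norm_square[of v] by (simp add: mult.commute)
    have phi: "phi_z t (of_real R * v) = of_real (t * R / D) * cnj v"
      by (simp add: phi_z_def norm_mult nv D_def)
    have "cnj v * w = - of_real (D powr t) * (cnj v * v) * (of_real (cos x) - \<i> * of_real (sin x))"
      unfolding w_def cis_x v_def by (simp add: mult_ac)
    then have vw: "cnj v * w = - of_real (D powr t) * (of_real (cos x) - \<i> * of_real (sin x))"
      by (simp add: vv)
    have "of_real (R / (n * sin x) * D powr - t) * (- 2 * phi_z t (of_real R * v) * w\<^sup>2)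
       = - of_real (2 * t * R\<^sup>2 / (n * D * sin x) * D powr - t) * (cnj v * w) * w"
      unfolding phi by (simp add: power2_eq_square mult_ac)
    also have "\<dots> = of_real (2 * t * R\<^sup>2 / (n * D * sin x) * (D powr - t * D powr t)) * (of_real (cos x) - \<i> * of_real (sin x)) * w"
      unfolding vw by simp
    also have "\<dots> = of_real (2 * t * R\<^sup>2 / (n * D * sin x)) * (of_real (cos x) - \<i> * of_real (sin x)) * w"
      unfolding p by simp
    also have "\<dots> = of_real (1 / n - 1) * \<i> * w + of_real (2 * t * R\<^sup>2 * cos x / (n * D * sin x)) * w"
      unfolding n1 using n D sx by (simp add: field_simps)
    finally show ?thesis
      unfolding w_def by (simp add: R_def[symmetric] n_def[symmetric] D_def[symmetric])
  qed
  ultimately show "((\<lambda>x. - of_real ((1 - (r x)\<^sup>2) powr t) * (u * cis (\<theta> x - x))) has_vector_derivative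
     of_real (r x / (clairaut_slope t (r x) * sin x) * (1 - (r x)\<^sup>2) powr - t)
      * (- 2 * phi_z t (of_real (r x) * (u * cis (\<theta> x))) * (- of_real ((1 - (r x)\<^sup>2) powr t) * (u * cis (\<theta> x - x)))\<^sup>2))
     (at x within {a..b})"
    unfolding w_def v_def n_def D_def R_def by (simp only: of_real_minus)
qed

lemma clairaut_strict_mono:
  assumes t: "t \<ge> 0" and rs: "0 \<le> r" "r < s" "s < 1"
  shows "clairaut t r < clairaut t s"
proof -
  have s: "1 - s\<^sup>2 > 0" using rs by (simp add: abs_square_less_1)
  have "r\<^sup>2 \<le> s\<^sup>2" using rs by (intro power_mono) auto
  then have "(1 - r\<^sup>2) powr - t \<le> (1 - s\<^sup>2) powr - t"
    using s t by (intro powr_mono2') auto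
  then have "r * (1 - r\<^sup>2) powr - t \<le> r * (1 - s\<^sup>2) powr - t"
    using rs by (intro mult_left_mono) auto
  also have "\<dots> < s * (1 - s\<^sup>2) powr - t"
    using rs s by (intro mult_strict_right_mono) auto
  finally show ?thesis by (simp add: clairaut_def)
qed

lemma clairaut_inverse:
  fixes t R :: real
  assumes t: "t \<ge> 0" and R: "0 < R" "R < 1"
  obtains \<rho> where "\<And>r. 0 \<le> r \<Longrightarrow> r \<le> R \<Longrightarrow> \<rho> (clairaut t r) = r"
    and "continuous_on {0..clairaut t R} \<rho>"
    and "\<And>y. y \<in> {0..clairaut t R} \<Longrightarrow> 0 \<le> \<rho> y \<and> \<rho> y \<le> R"
    and "\<And>y. 0 < y \<Longrightarrow> y < clairaut t R \<Longrightarrow> 0 < \<rho> y"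
    and "\<And>y. 0 < y \<Longrightarrow> y < clairaut t R \<Longrightarrow>
      (\<rho> has_real_derivative \<rho> y / (y * clairaut_slope t (\<rho> y))) (at y)"
proof -
  define \<rho> where "\<rho> = inv_into {0..R} (clairaut t)"
  have d: "1 - r\<^sup>2 > 0" if "r \<in> {0..R}" for r
    using that R by (simp add: abs_square_less_1)
  have "inj_on (clairaut t) {0..R}"
  proof (rule inj_onI)
    fix r s assume "r \<in> {0..R}" "s \<in> {0..R}" "clairaut t r = clairaut t s"
    then show "r = s"
      using clairaut_strict_mono[OF t, of r s] clairaut_strict_mono[OF t, of s r] R
      by (cases r s rule: linorder_cases) auto
  qed
  then have \<rho>: "\<rho> (clairaut t r) = r" if "0 \<le> r" "r \<le> R" for r
    using that by (simp add: \<rho>_def)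
  have cont: "continuous_on {0..R} (clairaut t)"
    unfolding clairaut_def[abs_def] using d by (intro continuous_intros) force
  have zero: "clairaut t 0 = 0" by (simp add: clairaut_def)
  have surj: "\<exists>r\<in>{0..R}. clairaut t r = y" if "y \<in> {0..clairaut t R}" for y
    using IVT'[OF _ _ _ cont, of y] that R zero by auto
  have sub: "{0..clairaut t R} \<subseteq> clairaut t ` {0..R}" using surj by force
  have cont\<rho>: "continuous_on {0..clairaut t R} \<rho>"
    by (rule continuous_on_subset[OF continuous_on_inv[OF cont] sub]) (use \<rho> in auto)
  have range: "0 \<le> \<rho> y \<and> \<rho> y \<le> R" "clairaut t (\<rho> y) = y" if "y \<in> {0..clairaut t R}" for y
    using surj[OF that] \<rho> by auto
  have pos: "0 < \<rho> y" if y: "0 < y" "y < clairaut t R" for y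
    using range[of y] y zero by (cases "\<rho> y = 0") auto
  have der: "(\<rho> has_real_derivative \<rho> y / (y * clairaut_slope t (\<rho> y))) (at y)"
    if y: "0 < y" "y < clairaut t R" for y
  proof -
    define r where "r = \<rho> y"
    have r: "r \<in> {0..R}" "0 < r" "clairaut t r = y" using range[of y] pos[OF y] y by (auto simp: r_def)
    have slope: "clairaut_slope t r > 0"
      using d[OF r(1)] t unfolding clairaut_slope_def by (intro add_pos_nonneg divide_nonneg_pos) auto
    have "(clairaut t has_real_derivative (1 - r\<^sup>2) powr - t + r * (- t * (1 - r\<^sup>2) powr (- t - 1) * (- 2 * r))) (at r)"
      unfolding clairaut_def[abs_def] using d[OF r(1)] by (auto intro!: derivative_eq_intros)
    moreover have "(1 - r\<^sup>2) powr - t + r * (- t * (1 - r\<^sup>2) powr (- t - 1) * (- 2 * r)) = y * clairaut_slope t r / r"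
    proof -
      have "(1 - r\<^sup>2) powr (- t - 1) = (1 - r\<^sup>2) powr - t / (1 - r\<^sup>2)"
        using d[OF r(1)] by (simp add: powr_diff)
      moreover have "y = r * (1 - r\<^sup>2) powr - t" using r(3) by (simp add: clairaut_def)
      ultimately show ?thesis
        using r(2) by (simp add: clairaut_slope_def distrib_left power2_eq_square add_divide_distrib mult_ac)
    qed
    ultimately have "(clairaut t has_real_derivative y * clairaut_slope t r / r) (at (\<rho> y))"
      by (simp add: r_def)
    then have "(\<rho> has_real_derivative inverse (y * clairaut_slope t r / r)) (at y)"
    proof (rule DERIV_inverse_function[where a = 0 and b = "clairaut t R"])
      show "y * clairaut_slope t r / r \<noteq> 0" using y slope r by simp
      show "isCont \<rho> y"
        using continuous_on_interior[OF cont\<rho>, of y] y by simp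
    qed (use y range in auto)
    then show ?thesis by (simp add: r_def field_simps)
  qed
  show ?thesis by (rule that[of \<rho>]) (use \<rho> cont\<rho> range pos der in auto)
qed

lemma integral_affine:
  fixes f :: "real \<Rightarrow> real"
  assumes "a \<le> b" and cont: "continuous_on {a..b} f"
  shows "integral {a..b} f = (b - a) * integral {0..1} (\<lambda>x. f (a + x * (b - a)))"
proof (cases "a = b")
  case False
  have "(f has_integral integral {a..b} f) (cbox a b)"
    using integrable_integral[OF integrable_continuous_real[OF cont]] by simp
  from has_integral_affinity'[OF this, of "b - a" a]
  have "((\<lambda>x. f ((b - a) * x + a)) has_integral integral {a..b} f / (b - a)) {0..1}"
    using False assms(1) by (simp add: divide_inverse mult.commute)
  then have "integral {0..1} (\<lambda>x. f ((b - a) * x + a)) = integral {a..b} f / (b - a)"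
    by (rule integral_unique)
  then show ?thesis using False by (simp add: add.commute mult.commute)
qed simp

text \<open>
A geodesic that leaves the circle of radius \<open>r1\<close> with parameter \<open>a\<close> has the Clairaut constant \<open>m1 * sin a\<close> and
recedes through the circle of radius \<open>r2\<close> at the parameter \<open>b \<ge> \<pi> / 2\<close> with \<open>m2 * sin b = m1 * sin a\<close>; the
polar angle swept in between is the integral, where \<open>G\<close> is \<open>1 / clairaut_slope\<close> as a function of \<open>clairaut\<close>. As \<open>a\<close>
decreases from \<open>\<pi>\<close> to \<open>0\<close>, this angle \<open>\<Delta> a\<close> varies continuously from \<open>0\<close> to \<open>\<pi>\<close>: for small \<open>a\<close> the
geodesic passes close to the origin, and the integrand is close to \<open>G 0 = 1\<close> except near the ends. So it takes the value \<open>\<beta>\<close>.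
\<close>
lemma shooting_angle:
  fixes G :: "real \<Rightarrow> real"
  assumes m: "0 < m1" "m1 \<le> m2" and \<beta>: "0 < \<beta>" "\<beta> < pi"
    and contG: "continuous_on {0..m2} G" and G0: "G 0 = 1"
    and G01: "\<And>y. y \<in> {0..m2} \<Longrightarrow> 0 < G y \<and> G y \<le> 1"
  obtains a b where "0 < a" "a < b" "b < pi" "m2 * sin b = m1 * sin a"
    and "\<And>x. x \<in> {a..b} \<Longrightarrow> sin x > 0 \<and> m1 * sin a / sin x \<le> m2"
    and "integral {a..b} (\<lambda>x. G (m1 * sin a / sin x)) = \<beta>"
proof -
  \<comment> \<open>Extending \<open>G\<close> constantly makes the integrand continuous without restriction on its argument.\<close>
  define g where "g = (\<lambda>y. G (max 0 (min y m2)))"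
  have contg: "continuous_on UNIV g"
    unfolding g_def by (rule continuous_on_compose2[OF contG]) (use m in \<open>auto intro!: continuous_intros\<close>)
  have g01: "0 < g y" "g y \<le> 1" for y
    using G01[of "max 0 (min y m2)"] m by (auto simp: g_def)
  define B where "B = (\<lambda>a. pi - arcsin (m1 * sin a / m2))"
  have sin01: "0 < sin a" "sin a \<le> 1" "0 < m1 * sin a / m2" "m1 * sin a / m2 \<le> sin a"
    if "0 < a" "a < pi" for a
  proof -
    show s: "0 < sin a" "sin a \<le> 1" using that by (auto intro: sin_gt_zero)
    show "0 < m1 * sin a / m2" using m s by simp
    show "m1 * sin a / m2 \<le> sin a" using m s by (simp add: divide_simps mult_right_mono)
  qed
  have B: "pi / 2 \<le> B a" "B a < pi" "sin (B a) = m1 * sin a / m2" "a \<le> B a" if a: "0 < a" "a < pi" for a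
  proof -
    note s = sin01[OF a]
    have le1: "m1 * sin a / m2 \<le> 1" using s by linarith
    show "pi / 2 \<le> B a" using arcsin_ubound[of "m1 * sin a / m2"] s le1 by (simp add: B_def)
    have "arcsin (m1 * sin a / m2) > arcsin 0"
      using s le1 by (intro arcsin_less_arcsin) auto
    then show "B a < pi" by (simp add: B_def)
    show sB: "sin (B a) = m1 * sin a / m2" using s le1 by (simp add: B_def)
    show "a \<le> B a"
    proof (cases "a \<le> pi / 2")
      case False
      have "arcsin (m1 * sin a / m2) \<le> arcsin (sin (pi - a))"
        using s le1 by (intro arcsin_le_arcsin) auto
      also have "\<dots> = pi - a" using False a by (intro arcsin_sin) auto
      finally show ?thesis by (simp add: B_def)
    qed (use \<open>pi / 2 \<le> B a\<close> in simp)
  qed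
  have sin_range: "sin x > 0 \<and> m1 * sin a / sin x \<le> m2" if a: "0 < a" "a < pi" and x: "x \<in> {a..B a}" for a x
  proof -
    have "x < pi" using B(2)[OF a] x by auto
    then have sx: "sin x > 0" using a x by (intro sin_gt_zero) auto
    have "m1 * sin a / m2 \<le> sin x"
    proof (cases "x \<le> pi / 2")
      case True
      then have "sin a \<le> sin x" using a x by (intro sin_monotone_2pi_le) auto
      then show ?thesis using sin01(4)[OF a] by linarith
    next
      case False
      have "sin (pi - B a) \<le> sin (pi - x)"
        using a x False \<open>x < pi\<close> B[OF a] by (intro sin_monotone_2pi_le) auto
      then show ?thesis using B(3)[OF a] by simp
    qed
    then show ?thesis using sx m by (simp add: field_simps)
  qed
  define \<Delta> where "\<Delta> = (\<lambda>a. integral {a..B a} (\<lambda>x. g (m1 * sin a / sin x)))"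
  have contk: "continuous_on {a..B a} (\<lambda>x. g (m1 * sin a / sin x))" if a: "0 < a" "a < pi" for a
    using sin_range[OF a] by (intro continuous_on_compose2[OF contg] continuous_intros) force+
  have intk: "(\<lambda>x. g (m1 * sin a / sin x)) integrable_on {u..v}" if "0 < a" "a < pi" "a \<le> u" "v \<le> B a" for a u v
    using that by (intro integrable_continuous_real continuous_on_subset[OF contk[of a]]) auto
  \<comment> \<open>Continuity of \<open>\<Delta>\<close> is seen after transforming to an interval that does not depend on \<open>a\<close>.\<close>
  have \<Delta>_eq: "\<Delta> a = (B a - a) * integral (cbox 0 1) (\<lambda>x. g (m1 * sin a / sin (a + x * (B a - a))))"
    if "0 < a" "a < pi" for a
    unfolding \<Delta>_def using integral_affine[OF B(4) contk] that by simp
  \<comment> \<open>The interval from \<open>\<xi>\<close> to \<open>\<pi> - \<xi>\<close> is longer than \<open>\<beta>\<close>. For small \<open>a\<close> it lies between \<open>a\<close> and \<open>B a\<close>, and there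
      the argument of \<open>g\<close> is so close to \<open>0\<close> that \<open>g\<close> exceeds the ratio \<open>q\<close> of \<open>\<beta>\<close> to its length.\<close>
  define \<xi> where "\<xi> = (pi - \<beta>) / 4"
  have \<xi>: "0 < \<xi>" "\<xi> < pi / 4" using \<beta> by (auto simp: \<xi>_def)
  have \<beta>\<xi>: "\<beta> < pi - 2 * \<xi>" using \<beta> by (simp add: \<xi>_def field_simps)
  have s\<xi>: "sin \<xi> > 0" using \<xi> by (intro sin_gt_zero) auto
  define q where "q = \<beta> / (pi - 2 * \<xi>)"
  have q: "q < 1" using \<beta>\<xi> \<beta> by (simp add: q_def divide_simps)
  have "g 0 = 1" using m by (simp add: g_def G0)
  moreover have "isCont g 0" using contg by (simp add: continuous_on_eq_continuous_at)
  ultimately have "\<forall>\<^sub>F y in at 0. g y > q"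
    using q by (auto simp: isCont_def intro: order_tendstoD(1))
  then obtain y0 where y0: "y0 > 0" "\<And>y. 0 < y \<Longrightarrow> y \<le> y0 \<Longrightarrow> g y > q"
    unfolding eventually_at_le by (force simp: dist_real_def)
  define \<epsilon> where "\<epsilon> = min \<xi> (y0 * sin \<xi> / m1)"
  have \<epsilon>: "0 < \<epsilon>" "\<epsilon> \<le> \<xi>" "\<epsilon> < pi" "\<epsilon> \<le> pi - \<beta>" "m1 * \<epsilon> \<le> y0 * sin \<xi>"
  proof -
    show "0 < \<epsilon>" "\<epsilon> \<le> \<xi>" using \<xi> y0 s\<xi> m by (auto simp: \<epsilon>_def)
    then show "\<epsilon> < pi" "\<epsilon> \<le> pi - \<beta>" using \<xi> by (auto simp: \<xi>_def)
    have "m1 * \<epsilon> \<le> m1 * (y0 * sin \<xi> / m1)"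
      using m by (intro mult_left_mono) (auto simp: \<epsilon>_def)
    then show "m1 * \<epsilon> \<le> y0 * sin \<xi>" using m by simp
  qed
  have "\<Delta> \<epsilon> \<ge> \<beta>"
  proof -
    have "arcsin (m1 * sin \<epsilon> / m2) \<le> arcsin (sin \<xi>)"
    proof (rule arcsin_le_arcsin)
      have "sin \<epsilon> \<le> sin \<xi>" using \<epsilon> \<xi> by (intro sin_monotone_2pi_le) auto
      then show "m1 * sin \<epsilon> / m2 \<le> sin \<xi>" using sin01[of \<epsilon>] \<epsilon> by linarith
      show "- 1 \<le> m1 * sin \<epsilon> / m2" using sin01[of \<epsilon>] \<epsilon> by linarith
    qed auto
    also have "\<dots> = \<xi>" using \<xi> by (intro arcsin_sin) auto
    finally have B\<xi>: "pi - \<xi> \<le> B \<epsilon>" by (simp add: B_def)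
    have "integral {\<xi>..pi - \<xi>} (\<lambda>x. q) \<le> integral {\<xi>..pi - \<xi>} (\<lambda>x. g (m1 * sin \<epsilon> / sin x))"
    proof (rule integral_le)
      fix x assume x: "x \<in> {\<xi>..pi - \<xi>}"
      have "sin \<xi> \<le> sin x"
      proof (cases "x \<le> pi / 2")
        case True
        then show ?thesis using x \<xi> by (intro sin_monotone_2pi_le) auto
      next
        case False
        have "sin \<xi> \<le> sin (pi - x)" using x \<xi> False by (intro sin_monotone_2pi_le) auto
        then show ?thesis by simp
      qed
      moreover have "m1 * sin \<epsilon> \<le> m1 * \<epsilon>" using sin_x_le_x[of \<epsilon>] \<epsilon> m by simp
      ultimately have "m1 * sin \<epsilon> \<le> y0 * sin x"
        using \<epsilon>(5) mult_left_mono[of "sin \<xi>" "sin x" y0] y0(1) by linarith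
      moreover have "0 < sin x" using \<open>sin \<xi> \<le> sin x\<close> s\<xi> by linarith
      ultimately have "0 < m1 * sin \<epsilon> / sin x" "m1 * sin \<epsilon> / sin x \<le> y0"
        using sin01[of \<epsilon>] \<epsilon> m by (auto simp: divide_simps)
      then show "q \<le> g (m1 * sin \<epsilon> / sin x)" using y0(2) by (simp add: less_imp_le)
    qed (use intk[of \<epsilon> \<xi> "pi - \<xi>"] \<epsilon> B\<xi> in auto)
    also have "\<dots> \<le> \<Delta> \<epsilon>"
      unfolding \<Delta>_def using \<epsilon> B\<xi> g01
      by (intro integral_subset_le intk) (auto simp: less_imp_le)
    finally have "q * (pi - 2 * \<xi>) \<le> \<Delta> \<epsilon>" using \<xi> by (simp add: mult.commute)
    then show ?thesis using \<beta>\<xi> \<beta> by (simp add: q_def)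
  qed
  moreover have "\<Delta> (pi - \<beta>) \<le> \<beta>"
  proof -
    have ab: "0 < pi - \<beta>" "pi - \<beta> < pi" using \<beta> by auto
    have "\<Delta> (pi - \<beta>) \<le> integral {pi - \<beta>..B (pi - \<beta>)} (\<lambda>x. 1)"
      unfolding \<Delta>_def using g01 intk[OF ab] by (intro integral_le) auto
    also have "\<dots> \<le> \<beta>" using B(2)[OF ab] B(4)[OF ab] by simp
    finally show ?thesis .
  qed
  moreover have "continuous_on {\<epsilon>..pi - \<beta>} \<Delta>"
  proof -
    have in01: "0 < a" "a < pi" if "a \<in> {\<epsilon>..pi - \<beta>}" for a using that \<epsilon> \<beta> by auto
    have "- 1 \<le> m1 * sin a / m2 \<and> m1 * sin a / m2 \<le> 1" if "a \<in> {\<epsilon>..pi - \<beta>}" for a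
      using sin01[OF in01[OF that]] by linarith
    then have contB: "continuous_on {\<epsilon>..pi - \<beta>} B"
      unfolding B_def using m by (intro continuous_intros ballI) auto
    have "continuous_on ({\<epsilon>..pi - \<beta>} \<times> cbox 0 1) (\<lambda>p. g (m1 * sin (fst p) / sin (fst p + snd p * (B (fst p) - fst p))))"
    proof (intro continuous_on_compose2[OF contg] continuous_intros subset_UNIV ballI)
      show "continuous_on ({\<epsilon>..pi - \<beta>} \<times> cbox 0 1) (\<lambda>p. B (fst p))"
        by (rule continuous_on_compose2[OF contB]) (auto intro: continuous_intros)
      fix p assume "p \<in> {\<epsilon>..pi - \<beta>} \<times> cbox 0 (1::real)"
      then have p: "fst p \<in> {\<epsilon>..pi - \<beta>}" "0 \<le> snd p" "snd p \<le> 1" by auto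
      note a = in01[OF p(1)]
      have "snd p * (B (fst p) - fst p) \<le> 1 * (B (fst p) - fst p)"
        using p B(4)[OF a] by (intro mult_right_mono) auto
      then have "fst p + snd p * (B (fst p) - fst p) \<in> {fst p..B (fst p)}"
        using p B(4)[OF a] by auto
      from sin_range[OF a this] show "sin (fst p + snd p * (B (fst p) - fst p)) \<noteq> 0" by simp
    qed
    then have "continuous_on {\<epsilon>..pi - \<beta>} (\<lambda>a. integral (cbox 0 1) (\<lambda>x. g (m1 * sin a / sin (a + x * (B a - a)))))"
      by (intro integral_continuous_on_param) (simp add: case_prod_beta')
    then have "continuous_on {\<epsilon>..pi - \<beta>} (\<lambda>a. (B a - a) * integral (cbox 0 1) (\<lambda>x. g (m1 * sin a / sin (a + x * (B a - a)))))"
      by (intro continuous_intros contB)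
    then show ?thesis
      by (rule continuous_on_eq) (use \<Delta>_eq in01 in auto)
  qed
  ultimately obtain a where a': "a \<in> {\<epsilon>..pi - \<beta>}" and \<Delta>a: "\<Delta> a = \<beta>"
    using IVT2'[of \<Delta> "pi - \<beta>" \<beta> \<epsilon>] \<epsilon>(4) by auto
  have a: "0 < a" "a < pi" using a' \<epsilon> \<beta> by auto
  have "a \<noteq> B a" using \<Delta>a \<beta> by (auto simp: \<Delta>_def)
  then have "a < B a" using B(4)[OF a] by simp
  have gG: "g (m1 * sin a / sin x) = G (m1 * sin a / sin x)" if "x \<in> {a..B a}" for x
  proof -
    have "0 \<le> m1 * sin a / sin x" using sin_range[OF a that] sin01[OF a] m by simp
    then show ?thesis using sin_range[OF a that] by (simp add: g_def)
  qed
  have "integral {a..B a} (\<lambda>x. G (m1 * sin a / sin x)) = \<Delta> a"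
    unfolding \<Delta>_def by (rule integral_cong) (simp add: gG)
  then show ?thesis
    using that[of a "B a"] a \<open>a < B a\<close> B[OF a] sin_range[OF a] \<Delta>a m by simp
qed

text \<open>
The radius is recovered from Clairaut's relation as \<open>\<rho> (m1 * sin a / sin x)\<close>. The inverse \<open>\<rho>\<close> of \<open>clairaut t\<close> is
needed slightly beyond \<open>r2\<close>, up to \<open>R\<close>, in order that it be differentiable at the far end of the arc.
\<close>
lemma geodesic_arc_off_diameter:
  assumes t: "t \<ge> 0" and u: "norm u = 1" and r12: "0 < r1" "r1 \<le> r2" "r2 < 1" and \<beta>: "0 < \<beta>" "\<beta> < pi"
  shows "\<exists>a b z w l. geodesic_arc t a b z w l \<and> z a = of_real r1 * u \<and> z b = of_real r2 * (u * cis \<beta>)"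
proof -
  define R where "R = (1 + r2) / 2"
  have R: "0 < R" "R < 1" "r2 < R" using r12 by (auto simp: R_def)
  obtain \<rho> where \<rho>: "\<And>r. 0 \<le> r \<Longrightarrow> r \<le> R \<Longrightarrow> \<rho> (clairaut t r) = r"
    and cont\<rho>: "continuous_on {0..clairaut t R} \<rho>"
    and range: "\<And>y. y \<in> {0..clairaut t R} \<Longrightarrow> 0 \<le> \<rho> y \<and> \<rho> y \<le> R"
    and pos: "\<And>y. 0 < y \<Longrightarrow> y < clairaut t R \<Longrightarrow> 0 < \<rho> y"
    and der: "\<And>y. 0 < y \<Longrightarrow> y < clairaut t R \<Longrightarrow>
      (\<rho> has_real_derivative \<rho> y / (y * clairaut_slope t (\<rho> y))) (at y)"
    using clairaut_inverse[OF t R(1,2)] by metis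
  define m1 m2 where "m1 = clairaut t r1" and "m2 = clairaut t r2"
  have zero: "clairaut t 0 = 0" by (simp add: clairaut_def)
  have m: "0 < m1" "m1 \<le> m2" "m2 < clairaut t R"
    using clairaut_strict_mono[OF t, of 0 r1] clairaut_strict_mono[OF t, of r1 r2]
      clairaut_strict_mono[OF t, of r2 R] r12 R zero
    by (cases "r1 = r2"; force simp: m1_def m2_def)+
  define G where "G = (\<lambda>y. 1 / clairaut_slope t (\<rho> y))"
  have slope: "clairaut_slope t (\<rho> y) \<ge> 1" and d: "1 - (\<rho> y)\<^sup>2 > 0" if "y \<in> {0..m2}" for y
  proof -
    have y: "y \<in> {0..clairaut t R}" using that m by auto
    then show d: "1 - (\<rho> y)\<^sup>2 > 0" using range[OF y] R by (simp add: abs_square_less_1)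
    then show "clairaut_slope t (\<rho> y) \<ge> 1" using t by (simp add: clairaut_slope_def)
  qed
  have cont\<rho>2: "continuous_on {0..m2} \<rho>"
    by (rule continuous_on_subset[OF cont\<rho>]) (use m in auto)
  have contG: "continuous_on {0..m2} G"
  proof -
    have "continuous_on {0..m2} (\<lambda>y. clairaut_slope t (\<rho> y))"
      unfolding clairaut_slope_def using d by (intro continuous_intros cont\<rho>2) force
    then show ?thesis unfolding G_def using slope by (intro continuous_intros) force+
  qed
  have G0: "G 0 = 1" using \<rho>[of 0] R zero by (simp add: G_def clairaut_slope_def)
  have G01: "0 < G y \<and> G y \<le> 1" if "y \<in> {0..m2}" for y
    using slope[OF that] by (simp add: G_def)
  obtain a b where ab: "0 < a" "a < b" "b < pi" and sinb: "m2 * sin b = m1 * sin a"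
    and sin: "\<And>x. x \<in> {a..b} \<Longrightarrow> sin x > 0 \<and> m1 * sin a / sin x \<le> m2"
    and int: "integral {a..b} (\<lambda>x. G (m1 * sin a / sin x)) = \<beta>"
    using shooting_angle[OF m(1,2) \<beta> contG G0 G01] by metis
  define y where "y = (\<lambda>x. m1 * sin a / sin x)"
  have y: "0 < y x" "y x \<le> m2" if "x \<in> {a..b}" for x
    using sin[OF that] sin[of a] ab m by (auto simp: y_def)
  define r where "r = (\<lambda>x. \<rho> (y x))"
  define \<theta> where "\<theta> = (\<lambda>x. integral {a..x} (\<lambda>x. G (y x)))"
  have dy: "(y has_real_derivative - (y x * cos x / sin x)) (at x within {a..b})" if x: "x \<in> {a..b}" for x
    unfolding y_def using sin[OF x] by (auto intro!: derivative_eq_intros simp: power2_eq_square field_simps)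
  have conty: "continuous_on {a..b} y"
    using dy by (meson DERIV_continuous continuous_on_eq_continuous_within)
  have contGy: "continuous_on {a..b} (\<lambda>x. G (y x))"
    by (rule continuous_on_compose2[OF contG conty]) (use y in \<open>force intro: less_imp_le\<close>)
  have "geodesic_arc t a b (\<lambda>x. of_real (r x) * (u * cis (\<theta> x)))
     (\<lambda>x. - of_real ((1 - (r x)\<^sup>2) powr t) * (u * cis (\<theta> x - x)))
     (\<lambda>x. r x / (clairaut_slope t (r x) * sin x) * (1 - (r x)\<^sup>2) powr - t)"
  proof (rule geodesic_arc_of_clairaut[OF u ab t])
    fix x assume x: "x \<in> {a..b}"
    have yx: "0 < y x" "y x < clairaut t R" using y[OF x] m by auto
    show "0 < r x \<and> r x < 1" using pos[OF yx] range[of "y x"] yx R by (auto simp: r_def)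
    show "(r has_real_derivative - (r x * cos x / (clairaut_slope t (r x) * sin x))) (at x within {a..b})"
      unfolding r_def
      by (rule DERIV_cong[OF DERIV_chain2[OF der[OF yx] dy[OF x]]]) (use yx in simp)
    show "(\<theta> has_real_derivative 1 / clairaut_slope t (r x)) (at x within {a..b})"
      using integral_has_real_derivative[OF contGy x] by (simp add: \<theta>_def G_def r_def)
  qed
  moreover have "r a = r1" "r b = r2" "\<theta> a = 0" "\<theta> b = \<beta>"
  proof -
    have "y a = m1" using sin[of a] ab by (simp add: y_def)
    then show "r a = r1" using \<rho>[of r1] r12 R by (simp add: r_def m1_def)
    have "y b = m2" using sin[of b] ab sinb by (simp add: y_def field_simps)
    then show "r b = r2" using \<rho>[of r2] r12 R by (simp add: r_def m2_def)
    show "\<theta> a = 0" "\<theta> b = \<beta>" using int by (simp_all add: \<theta>_def y_def)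
  qed
  ultimately show ?thesis
    by (intro exI conjI) (assumption, simp_all)
qed

text \<open>
The order of the end points is left open, which saves the reversal of arcs.
\<close>
lemma geodesic_arc_exists:
  assumes t: "t \<ge> 0" and z: "z1 \<in> ball 0 1" "z2 \<in> ball 0 1" "z1 \<noteq> z2"
  shows "\<exists>a b z w l. geodesic_arc t a b z w l \<and> {z a, z b} = {z1, z2}"
proof -
  have ordered: "\<exists>a b z w l. geodesic_arc t a b z w l \<and> {z a, z b} = {z1, z2}"
    if z: "z1 \<in> ball 0 1" "z2 \<in> ball 0 1" "z1 \<noteq> z2" and le: "norm z1 \<le> norm z2" for z1 z2
  proof -
    have diam: ?thesis if u: "norm u = 1" and z12: "z1 = of_real x * u" "z2 = of_real y * u" for u and x y :: real
    proof -
      have xy: "\<bar>x\<bar> < 1" "\<bar>y\<bar> < 1" "x \<noteq> y" using z u by (auto simp: z12 norm_mult)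
      show ?thesis
      proof (cases "x < y")
        case True
        then show ?thesis
          using geodesic_arc_diameter[OF u, of x y t] xy unfolding z12 by fastforce
      next
        case False
        then have "geodesic_arc t y x (\<lambda>s. of_real s * u) (\<lambda>s. of_real ((1 - s\<^sup>2) powr t) * u) (\<lambda>s. (1 - s\<^sup>2) powr - t)"
          using geodesic_arc_diameter[OF u, of y x t] xy by auto
        then show ?thesis unfolding z12 by (fastforce simp: insert_commute)
      qed
    qed
    define r1 r2 where "r1 = norm z1" and "r2 = norm z2"
    have r2: "0 < r2" "r2 < 1" using z le by (auto simp: r2_def)
    show ?thesis
    proof (cases "z1 = 0")
      case True
      have "norm (z2 / of_real r2) = 1" using r2 by (simp add: norm_divide r2_def)
      then show ?thesis using diam[of "z2 / of_real r2" 0 r2] r2 True by simp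
    next
      case False
      then have r1: "0 < r1" "r1 \<le> r2" using le by (auto simp: r1_def r2_def)
      define u where "u = z1 / of_real r1"
      have u: "norm u = 1" "z1 = of_real r1 * u" using r1 by (simp_all add: u_def norm_divide) (simp add: r1_def)
      define v where "v = z2 / (of_real r2 * u)"
      have u0: "u \<noteq> 0" using u by auto
      have v: "norm v = 1" "z2 = of_real r2 * (u * v)"
        using r2 u u0 by (simp_all add: v_def norm_divide norm_mult) (simp add: r2_def)
      define \<beta> where "\<beta> = Arg v"
      have vc: "v = cis \<beta>" using v(1) by (metis Arg_def \<beta>_def cis_Arg norm_eq_zero sgn_eq zero_neq_one of_real_1 div_by_1)
      have \<beta>: "- pi < \<beta>" "\<beta> \<le> pi" using Arg_bounded[of v] by (auto simp: \<beta>_def)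
      consider "\<beta> = 0" | "\<beta> = pi" | "0 < \<beta>" "\<beta> < pi" | "\<beta> < 0" using \<beta> by linarith
      then show ?thesis
      proof cases
        case 1
        then show ?thesis using diam[OF u, of r2] v(2) vc by simp
      next
        case 2
        then show ?thesis using diam[OF u, of "- r2"] v(2) vc by simp
      next
        case 3
        then show ?thesis
          using geodesic_arc_off_diameter[OF t u(1) r1 r2(2) 3] u(2) v(2) vc by metis
      next
        case 4
        have "norm (cnj u) = 1" using u by simp
        from geodesic_arc_off_diameter[OF t this r1 r2(2), of "- \<beta>"] 4 \<beta>
        obtain a b z w l where geo: "geodesic_arc t a b z w l"
          and ends: "z a = of_real r1 * cnj u" "z b = of_real r2 * (cnj u * cis (- \<beta>))" by auto
        have "cnj (z a) = z1" "cnj (z b) = z2"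
          by (simp_all add: ends u(2) v(2) vc cis_cnj)
        then show ?thesis using geodesic_arc_cnj[OF geo] by metis
      qed
    qed
  qed
  show ?thesis
    using ordered[OF z] ordered[of z2 z1] z by (metis insert_commute linear)
qed

section \<open>Double points of the lift\<close>

lemma positive_between_consecutive_zeros:
  fixes n :: "real \<Rightarrow> real"
  assumes cont: "continuous_on {a..b} n" and nonneg: "\<And>x. x \<in> {a..b} \<Longrightarrow> n x \<ge> 0"
    and zeros: "n a = 0" "n b = 0" and c: "c \<in> {a..b}" "n c > 0"
  obtains a' b' where "a \<le> a'" "a' < b'" "b' \<le> b" "n a' = 0" "n b' = 0"
    "\<And>x. a' < x \<Longrightarrow> x < b' \<Longrightarrow> n x > 0"
proof -
  have compact: "compact ({x..y} \<inter> n -` {0})" if "a \<le> x" "y \<le> b" for x y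
  proof -
    have "continuous_on {x..y} n" using that by (intro continuous_on_subset[OF cont]) auto
    then have "closed ({x..y} \<inter> n -` {0})" by (rule continuous_closed_preimage) auto
    then show ?thesis by (simp add: compact_eq_bounded_closed bounded_Int)
  qed
  have "a \<in> {a..c} \<inter> n -` {0}" "b \<in> {c..b} \<inter> n -` {0}" using zeros c by auto
  then have ne: "{a..c} \<inter> n -` {0} \<noteq> {}" "{c..b} \<inter> n -` {0} \<noteq> {}" by blast+
  obtain a' where a': "a' \<in> {a..c} \<inter> n -` {0}" "\<And>x. x \<in> {a..c} \<inter> n -` {0} \<Longrightarrow> x \<le> a'"
    using compact_attains_sup[OF compact ne(1)] c by (metis atLeastAtMost_iff order_refl)
  obtain b' where b': "b' \<in> {c..b} \<inter> n -` {0}" "\<And>x. x \<in> {c..b} \<inter> n -` {0} \<Longrightarrow> b' \<le> x"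
    using compact_attains_inf[OF compact ne(2)] c by (metis atLeastAtMost_iff order_refl)
  have "a' \<noteq> c" "b' \<noteq> c" using a' b' c by auto
  then have "a' < c" "c < b'" using a' b' by auto
  show ?thesis
  proof (rule that[of a' b'])
    fix x assume x: "a' < x" "x < b'"
    have "n x \<noteq> 0"
      using a'(1) b'(1) a'(2)[of x] b'(2)[of x] x by (cases "x \<le> c") auto
    then show "n x > 0" using nonneg[of x] x a'(1) b'(1) by force
  qed (use a' b' \<open>a' < c\<close> \<open>c < b'\<close> in auto)
qed

context weierstrass_data
begin

text \<open>
The differential inequality is singular at the zeros of \<open>dist2\<close>, so that the comparison is made between two
consecutive zeros. These exist unless \<open>dist2\<close> vanishes on the whole arc, which would contradict that the lift
is an immersion.
\<close>
lemma double_point_on_short_geodesic_impossible: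
  assumes t: "t \<ge> 0" and \<kappa>: "\<kappa> > 0"
    and bound: "\<And>z. z \<in> ball 0 1 \<Longrightarrow>
      norm (schwarzian h g z - of_real (2 * t * (1 - t)) * (cnj z)\<^sup>2 / of_real ((1 - (norm z)\<^sup>2)\<^sup>2))
        + exp (2 * conformal_log h g z) * \<bar>gauss_curvature h g z\<bar>
      \<le> 2 * t / (1 - (norm z)\<^sup>2)\<^sup>2 + 2 * \<kappa>\<^sup>2 / (1 - (norm z)\<^sup>2) powr (2 * t)"
    and geo: "geodesic_arc t a b z w l" and short: "\<kappa> * integral {a..b} l < pi"
    and zeros: "dist2 p r (z a) = 0" "dist2 p r (z b) = 0"
  shows False
proof -
  note g = geodesic_arcD[OF geo]
  have interior: "at x within {a..b} = at x" if "a < x" "x < b" for x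
    using that by (rule at_within_Icc_at)
  have dz: "(z has_vector_derivative of_real (l x) * w x) (at x)" if "a < x" "x < b" for x
    using g(6)[of x] that interior[OF that] by simp
  have dw: "(w has_vector_derivative of_real (l x) * (- 2 * phi_z t (z x) * (w x)\<^sup>2)) (at x)" if "a < x" "x < b" for x
    using g(7)[of x] that interior[OF that] by simp
  have contz: "continuous_on {a..b} z"
    using g(6) by (rule continuous_on_vector_derivative)
  have cont: "continuous_on {a..b} (\<lambda>x. F (z x))"
    if "\<And>y. y \<in> ball 0 1 \<Longrightarrow> (F has_derivative F' y) (at y)" for F :: "complex \<Rightarrow> real" and F'
  proof (rule continuous_on_compose2[OF _ contz])
    show "continuous_on (ball 0 1) F"
      using that has_derivative_continuous by (blast intro: continuous_at_imp_continuous_on)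
  qed (use g(4) in auto)
  define n where "n = (\<lambda>x. dist2 p r (z x))"
  have contn: "continuous_on {a..b} n"
    unfolding n_def by (rule cont) (rule dist2_has_derivative)
  have nonneg: "n x \<ge> 0" for x by (simp add: n_def dist2_def)
  have "\<exists>c\<in>{a..b}. n c > 0"
  proof (rule ccontr)
    assume "\<not> ?thesis"
    then have n0: "dist2 p r (z x) = 0" if "x \<in> {a..b}" for x
      using that nonneg[of x] by (force simp: n_def)
    then have F0: "horizontal p (z x) = 0" "vertical r (z x) = 0" if "x \<in> {a..b}" for x
      using that by (auto simp: dist2_def add_nonneg_eq_0_iff)
    then have \<alpha>0: "dist2_z p r (z x) = 0" if "x \<in> {a..b}" for x
      using that by (simp add: dist2_z_def)
    define c where "c = (a + b) / 2"
    have c: "a < c" "c < b" using g(1) by (auto simp: c_def)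
    have cin: "c \<in> {a..b}" using c by simp
    have zc: "z c \<in> ball 0 1" using g(4)[OF cin] .
    \<comment> \<open>Where the displacement vanishes, the derivative of \<open>dist2_z\<close> reduces to the conformal factor.\<close>
    have "((\<lambda>x. dist2_z p r (z x)) has_vector_derivative of_real (E (z c)) * cnj (of_real (l c) * w c)) (at c)"
      using has_vector_derivative_compose[OF dist2_z_has_derivative[OF zc, of p r] dz[OF c]]
      by (simp add: dist2_normal_def F0[OF cin] \<alpha>0[OF cin])
    moreover have "((\<lambda>x. dist2_z p r (z x)) has_vector_derivative 0) (at c)"
      by (rule has_vector_derivative_transform_within_open[OF has_vector_derivative_const[of 0] open_greaterThanLessThan[of a b]])
         (use c \<alpha>0 in auto)
    ultimately have "of_real (E (z c)) * cnj (of_real (l c) * w c) = 0"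
      by (rule vector_derivative_unique_at)
    then have "w c = 0" using E_pos[OF zc] g(3)[OF cin] by simp
    then show False
      using g(5)[OF cin] one_minus_norm_square_pos[OF zc] by simp
  qed
  then obtain c where c: "c \<in> {a..b}" "n c > 0" by blast
  obtain a' b' where ab': "a \<le> a'" "a' < b'" "b' \<le> b" "n a' = 0" "n b' = 0"
    and pos: "\<And>x. a' < x \<Longrightarrow> x < b' \<Longrightarrow> n x > 0"
    using positive_between_consecutive_zeros[OF contn nonneg _ _ c] zeros unfolding n_def by metis
  define S where "S = (\<lambda>x. - t * ln (1 - (norm (z x))\<^sup>2) - conformal_log h g (z x))"
  define u where "u = (\<lambda>x. ln (dist2 p r (z x)) - t * ln (1 - (norm (z x))\<^sup>2) - conformal_log h g (z x))"
  define u1 where "u1 = (\<lambda>x. 2 * Re (dist2_z p r (z x) * w x) / dist2 p r (z x)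
      + 2 * Re ((phi_z t (z x) - sigma_z (z x)) * w x))"
  have der1: "(u has_real_derivative l x * u1 x) (at x)" if x: "a' < x" "x < b'" for x
    unfolding u_def u1_def using x ab' pos[OF x] g(4)[of x] dz[of x] dw[of x]
    by (intro log_distance_along_curve(1)) (auto simp: n_def)
  have "\<exists>u2. (u1 has_real_derivative l x * u2) (at x) \<and> u2 / 2 + (u1 x)\<^sup>2 / 4 \<ge> - \<kappa>\<^sup>2" if x: "a' < x" "x < b'" for x
  proof -
    have xin: "x \<in> {a..b}" and zx: "z x \<in> ball 0 1" and x': "a < x" "x < b" using x ab' g(4)[of x] by auto
    define d where "d = 1 - (norm (z x))\<^sup>2"
    have d: "d > 0" unfolding d_def by (rule one_minus_norm_square_pos[OF zx])
    define X where "X = norm (schwarzian h g (z x) - of_real (2 * t * (1 - t)) * (cnj (z x))\<^sup>2 / of_real ((1 - (norm (z x))\<^sup>2)\<^sup>2))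
            + exp (2 * conformal_log h g (z x)) * \<bar>gauss_curvature h g (z x)\<bar>"
    obtain u2 where u2: "(u1 has_real_derivative l x * u2) (at x)"
      "u2 / 2 + (u1 x)\<^sup>2 / 4 \<ge> (norm (w x))\<^sup>2 * (t / d\<^sup>2 - X / 2)"
      using log_distance_along_curve(2)[OF zx _ dz[OF x'] dw[OF x'], of p r] pos[OF x]
      unfolding u1_def n_def d_def X_def by blast
    have w2: "(norm (w x))\<^sup>2 = d powr (2 * t)"
      using g(5)[OF xin] d by (simp add: d_def power2_eq_square flip: powr_add)
    have "- \<kappa>\<^sup>2 = (norm (w x))\<^sup>2 * (- \<kappa>\<^sup>2 / d powr (2 * t))" using d by (simp add: w2)
    also have "\<dots> \<le> (norm (w x))\<^sup>2 * (t / d\<^sup>2 - X / 2)"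
    proof (rule mult_left_mono)
      have "X \<le> 2 * t / d\<^sup>2 + 2 * \<kappa>\<^sup>2 / d powr (2 * t)"
        using bound[OF zx] unfolding X_def d_def .
      moreover have "2 * t / d\<^sup>2 = 2 * (t / d\<^sup>2)" "2 * \<kappa>\<^sup>2 / d powr (2 * t) = 2 * (\<kappa>\<^sup>2 / d powr (2 * t))"
        "- \<kappa>\<^sup>2 / d powr (2 * t) = - (\<kappa>\<^sup>2 / d powr (2 * t))" by simp_all
      ultimately show "- \<kappa>\<^sup>2 / d powr (2 * t) \<le> t / d\<^sup>2 - X / 2" by linarith
    qed simp
    also note u2(2)
    finally show ?thesis using u2(1) by blast
  qed
  then obtain u2 where der2: "\<And>x. a' < x \<Longrightarrow> x < b' \<Longrightarrow> (u1 has_real_derivative l x * u2 x) (at x)"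
    and ineq: "\<And>x. a' < x \<Longrightarrow> x < b' \<Longrightarrow> u2 x / 2 + (u1 x)\<^sup>2 / 4 \<ge> - \<kappa>\<^sup>2"
    by metis
  have sub: "{a'..b'} \<subseteq> {a..b}" using ab' by auto
  have contS: "continuous_on {a'..b'} S"
  proof (rule continuous_on_subset[OF _ sub])
    show "continuous_on {a..b} S"
      unfolding S_def by (intro continuous_on_diff cont[OF phi_has_derivative] cont[OF conformal_log_has_derivative])
  qed
  have contn': "continuous_on {a'..b'} n" by (rule continuous_on_subset[OF contn sub])
  have u_eq: "u = (\<lambda>x. S x + ln (n x))" by (simp add: u_def S_def n_def fun_eq_iff)
  have lim: "filterlim u at_bot F"
    if "(S \<longlongrightarrow> s) F" "(n \<longlongrightarrow> 0) F" "\<forall>\<^sub>F x in F. n x > 0" for F s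
  proof -
    have "filterlim n (at_right 0) F"
      using that by (auto simp: filterlim_at elim: eventually_mono)
    then have "filterlim (\<lambda>x. ln (n x)) at_bot F" by (rule filterlim_compose[OF ln_at_0])
    then show ?thesis unfolding u_eq
      using that(1) by (simp add: filterlim_tendsto_add_at_bot_iff)
  qed
  have lim_a: "filterlim u at_bot (at_right a')"
  proof (rule lim)
    show "(S \<longlongrightarrow> S a') (at_right a')" by (rule continuous_on_Icc_at_rightD[OF contS ab'(2)])
    show "(n \<longlongrightarrow> 0) (at_right a')"
      using continuous_on_Icc_at_rightD[OF contn' ab'(2)] ab' by simp
    show "\<forall>\<^sub>F x in at_right a'. n x > 0"
      using eventually_at_right_real[OF ab'(2)] by eventually_elim (use pos in auto)
  qed
  have lim_b: "filterlim u at_bot (at_left b')"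
  proof (rule lim)
    show "(S \<longlongrightarrow> S b') (at_left b')" by (rule continuous_on_Icc_at_leftD[OF contS ab'(2)])
    show "(n \<longlongrightarrow> 0) (at_left b')"
      using continuous_on_Icc_at_leftD[OF contn' ab'(2)] ab' by simp
    show "\<forall>\<^sub>F x in at_left b'. n x > 0"
      using eventually_at_left_real[OF ab'(2)] by eventually_elim (use pos in auto)
  qed
  have "pi \<le> \<kappa> * integral {a'..b'} l"
    by (rule riccati_comparison[OF ab'(2) continuous_on_subset[OF g(2) sub] _ der1 der2 ineq \<kappa> lim_a lim_b])
       (use g(3) sub in auto)
  also have "\<dots> \<le> \<kappa> * integral {a..b} l"
  proof (rule mult_left_mono)
    have "l integrable_on {a'..b'}" "l integrable_on {a..b}"
      using continuous_on_subset[OF g(2) sub] g(2) by (auto intro: integrable_continuous_real)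
    then show "integral {a'..b'} l \<le> integral {a..b} l"
      using sub g(3) by (intro integral_subset_le) (auto simp: less_imp_le)
  qed (use \<kappa> in simp)
  finally show False using short by simp
qed

end

text \<open>
The function \<open>h' q\<close> is meromorphic and its square agrees with the analytic function \<open>h' g'\<close> off a discrete set.
So it has no poles, and removing its singularities yields an analytic function \<open>k\<close> with \<open>k\<^sup>2 = h' g'\<close>
everywhere. The segment of integration meets the discrete set where \<open>k\<close> and \<open>h' q\<close> differ in finitely
many points only.
\<close>
lemma weierstrass_data_of_dilatation:
  assumes harm: "harmonic_mapping f h g" and dil: "dilatation_is_square_of h g q" and base: "z0 \<in> ball 0 1"
  obtains K where "weierstrass_data h g K"
    and "\<And>z. z \<in> ball 0 1 \<Longrightarrow> weierstrass_enneper_lift f h q z0 z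
      = vector [Re (h z + cnj (g z)), Im (h z + cnj (g z)), 2 * Im (K z - K z0)]"
proof -
  have an: "h analytic_on ball 0 1" "g analytic_on ball 0 1"
    and f: "\<And>z. z \<in> ball 0 1 \<Longrightarrow> f z = h z + cnj (g z)"
    and nz: "\<And>z. z \<in> ball 0 1 \<Longrightarrow> norm (deriv h z) + norm (deriv g z) \<noteq> 0"
    using harm by (auto simp: harmonic_mapping_def)
  have mero_q: "q meromorphic_on ball 0 1"
    and ev: "\<And>z. z \<in> ball 0 1 \<Longrightarrow> \<forall>\<^sub>F w in at z. deriv h w \<noteq> 0 \<and> deriv g w / deriv h w = (q w)\<^sup>2"
    using dil by (auto simp: dilatation_is_square_of_def eventually_cosparse_open_eq)
  have an': "deriv h analytic_on ball 0 1" "deriv g analytic_on ball 0 1"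
    using an by (auto intro: analytic_deriv)
  define Q where "Q = (\<lambda>z. deriv h z * q z)"
  define k where "k = remove_sings Q"
  have "Q meromorphic_on ball 0 1"
    unfolding Q_def using analytic_on_imp_meromorphic_on[OF an'(1)] mero_q by (rule meromorphic_on_mult)
  then have sing: "isolated_singularity_at Q z" "not_essential Q z" if "z \<in> ball 0 1" for z
    using that by (auto simp: meromorphic_on_altdef)
  have lim: "\<exists>c. Q \<midarrow>z\<rightarrow> c \<and> c\<^sup>2 = deriv h z * deriv g z" if z: "z \<in> ball 0 1" for z
  proof -
    have eq: "\<forall>\<^sub>F w in at z. (Q w)\<^sup>2 = deriv h w * deriv g w"
      using ev[OF z]
    proof eventually_elim
      case (elim w)
      then have "deriv g w = (q w)\<^sup>2 * deriv h w" by (metis nonzero_divide_eq_eq)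
      then show ?case by (simp add: Q_def power2_eq_square mult_ac)
    qed
    have "(\<lambda>w. deriv h w * deriv g w) \<midarrow>z\<rightarrow> deriv h z * deriv g z"
      using an' z by (intro tendsto_mult isContD analytic_at_imp_isCont) (auto intro: analytic_on_subset)
    then have L: "(\<lambda>w. (Q w)\<^sup>2) \<midarrow>z\<rightarrow> deriv h z * deriv g z"
      using tendsto_cong[OF eq] by simp
    have "\<not> is_pole Q z"
    proof
      assume "is_pole Q z"
      then have "filterlim (\<lambda>w. (Q w)\<^sup>2) at_infinity (at z)"
        unfolding is_pole_def by (intro Limits.filterlim_power_at_infinity) auto
      then show False using not_tendsto_and_filterlim_at_infinity[OF _ L] by simp
    qed
    then obtain c where c: "Q \<midarrow>z\<rightarrow> c" using sing(2)[OF z] by (auto simp: not_essential_def)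
    then have "(\<lambda>w. (Q w)\<^sup>2) \<midarrow>z\<rightarrow> c\<^sup>2" by (intro tendsto_intros)
    then have "c\<^sup>2 = deriv h z * deriv g z" using L by (intro tendsto_unique) auto
    then show ?thesis using c by blast
  qed
  have k2: "(k z)\<^sup>2 = deriv h z * deriv g z" if "z \<in> ball 0 1" for z
    using lim[OF that] remove_sings_eqI unfolding k_def by blast
  have "k analytic_on {z}" if "z \<in> ball 0 1" for z
    unfolding k_def using lim[OF that] remove_sings_analytic_at[OF sing(1)[OF that]] by blast
  then have "k analytic_on ball 0 1" by (subst analytic_on_analytic_at) auto
  then have hol_k: "k holomorphic_on ball 0 1" by (rule analytic_imp_holomorphic)
  obtain K where K: "\<And>z. z \<in> ball 0 1 \<Longrightarrow> (K has_field_derivative k z) (at z within ball 0 1)"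
    using holomorphic_convex_primitive'[OF convex_ball open_ball hol_k] by blast
  have dK: "deriv K z = k z" if "z \<in> ball 0 1" for z
    using K[OF that] at_within_open[OF that open_ball] by (metis DERIV_imp_deriv)
  show ?thesis
  proof (rule that[of K])
    show "weierstrass_data h g K"
    proof
      show "K holomorphic_on ball 0 1" using K by (metis holomorphic_on_def field_differentiable_def)
    qed (use an nz k2 dK in \<open>auto intro: analytic_imp_holomorphic\<close>)
    fix z :: complex assume z: "z \<in> ball 0 1"
    have seg: "closed_segment z0 z \<subseteq> ball 0 1"
      using base z by (simp add: closed_segment_subset convex_ball)
    have "contour_integral (linepath z0 z) Q = contour_integral (linepath z0 z) k"
    proof (cases "z = z0")
      case False
      have "\<forall>\<^sub>F w in at y. k w = Q w" if "y \<in> ball 0 1" for y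
        unfolding k_def by (rule eventually_remove_sings_eq_at[OF sing(1)[OF that]])
      then have "{w. k w \<noteq> Q w} sparse_in ball 0 1"
        by (simp add: eventually_cosparse_open_eq flip: eventually_cosparse)
      then have "{w. k w \<noteq> Q w} sparse_in closed_segment z0 z" using seg by (rule sparse_in_subset)
      then have "finite (closed_segment z0 z \<inter> {w. k w \<noteq> Q w})"
        by (rule sparse_in_compact_finite) simp
      then show ?thesis
        by (rule contour_integral_spike_finite_simple_path)
           (use False in \<open>auto intro!: simple_path_linepath\<close>)
    qed simp
    also have "\<dots> = K z - K z0"
      using contour_integral_primitive[OF K, of "linepath z0 z"] seg
      by (intro contour_integral_unique) simp
    finally show "weierstrass_enneper_lift f h q z0 z
      = vector [Re (h z + cnj (g z)), Im (h z + cnj (g z)), 2 * Im (K z - K z0)]"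
      unfolding weierstrass_enneper_lift_def Q_def by (simp add: f[OF z])
  qed
qed

theorem corollary4p4:
  fixes f h g q :: "complex \<Rightarrow> complex" and z0 :: complex
  assumes harm: "harmonic_mapping f h g"
    and dil: "dilatation_is_square_of h g q"
    and base: "z0 \<in> ball 0 1"
    and bound:
      "(\<exists>t::real. t \<ge> 1 \<and>
          (\<forall>z\<in>ball 0 1.
             norm (schwarzian h g z -
                   of_real (2 * t * (1 - t)) * (cnj z)\<^sup>2 / of_real ((1 - (norm z)\<^sup>2)\<^sup>2))
               + exp (2 * conformal_log h g z) * \<bar>gauss_curvature h g z\<bar>
             \<le> 2 * t / (1 - (norm z)\<^sup>2)\<^sup>2)) \<or>
       (\<exists>t::real. 0 \<le> t \<and> t < 1 \<and>
          (\<forall>z\<in>ball 0 1.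
             norm (schwarzian h g z -
                   of_real (2 * t * (1 - t)) * (cnj z)\<^sup>2 / of_real ((1 - (norm z)\<^sup>2)\<^sup>2))
               + exp (2 * conformal_log h g z) * \<bar>gauss_curvature h g z\<bar>
             \<le> 2 * t / (1 - (norm z)\<^sup>2)\<^sup>2
               + 2 * pi / (1 - (norm z)\<^sup>2) powr (2 * t)
                 * (Gamma (3 / 2 - t) / Gamma (1 - t))\<^sup>2))"
  shows "inj_on (weierstrass_enneper_lift f h q z0) (ball 0 1)"
proof (rule inj_onI, rule ccontr)
  fix z1 z2 :: complex
  assume z: "z1 \<in> ball 0 1" "z2 \<in> ball 0 1" "z1 \<noteq> z2"
    and eq: "weierstrass_enneper_lift f h q z0 z1 = weierstrass_enneper_lift f h q z0 z2"
  obtain K where K: "weierstrass_data h g K"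
    and lift: "\<And>z. z \<in> ball 0 1 \<Longrightarrow> weierstrass_enneper_lift f h q z0 z
      = vector [Re (h z + cnj (g z)), Im (h z + cnj (g z)), 2 * Im (K z - K z0)]"
    using weierstrass_data_of_dilatation[OF harm dil base] by metis
  interpret weierstrass_data h g K by (rule K)
  define p r where "p = h z1 + cnj (g z1)" and "r = 2 * Im (K z1)"
  have "vector [Re (h z1 + cnj (g z1)), Im (h z1 + cnj (g z1)), 2 * Im (K z1 - K z0)] $ i
      = (vector [Re (h z2 + cnj (g z2)), Im (h z2 + cnj (g z2)), 2 * Im (K z2 - K z0)] :: real ^ 3) $ i" for i
    using eq z by (simp add: lift)
  from this[of 1] this[of 2] this[of 3]
  have "dist2 p r z1 = 0" "dist2 p r z2 = 0"
    by (simp_all add: dist2_def horizontal_def vertical_def p_def r_def complex_eq_iff vector_3)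
  then have double: "dist2 p r (c a) = 0" "dist2 p r (c b) = 0" if "{c a, c b} = {z1, z2}" for c :: "real \<Rightarrow> complex" and a b
    using that by (auto simp: doubleton_eq_iff)
  from bound show False
  proof (elim disjE exE conjE)
    fix t :: real
    assume t: "t \<ge> 1"
    assume b: "\<forall>z\<in>ball 0 1.
             norm (schwarzian h g z -
                   of_real (2 * t * (1 - t)) * (cnj z)\<^sup>2 / of_real ((1 - (norm z)\<^sup>2)\<^sup>2))
               + exp (2 * conformal_log h g z) * \<bar>gauss_curvature h g z\<bar>
             \<le> 2 * t / (1 - (norm z)\<^sup>2)\<^sup>2"
    have t0: "t \<ge> 0" using t by simp
    obtain x y c w l where geo: "geodesic_arc t x y c w l" and ends: "{c x, c y} = {z1, z2}"
      using geodesic_arc_exists[OF t0 z] by metis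
    define I where "I = integral {x..y} l"
    have "I \<ge> 0"
      unfolding I_def using geodesic_arcD(2,3)[OF geo]
      by (intro integral_nonneg integrable_continuous_real) (auto simp: less_imp_le)
    \<comment> \<open>Every inequality \<open>v'' \<ge> - \<kappa>\<^sup>2 v\<close> is available here; \<open>\<kappa>\<close> only has to be so small that \<open>\<kappa>\<close> times the length of the arc stays below \<open>\<pi>\<close>.\<close>
    define \<kappa> where "\<kappa> = pi / (I + 1)"
    have \<kappa>: "\<kappa> > 0" "\<kappa> * I < pi"
      using \<open>I \<ge> 0\<close> by (auto simp: \<kappa>_def field_simps)
    show False
    proof (rule double_point_on_short_geodesic_impossible[OF t0 \<kappa>(1) _ geo \<kappa>(2)[unfolded I_def] double[OF ends]])
      fix z :: complex assume "z \<in> ball 0 1"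
      with b show "norm (schwarzian h g z - of_real (2 * t * (1 - t)) * (cnj z)\<^sup>2 / of_real ((1 - (norm z)\<^sup>2)\<^sup>2))
        + exp (2 * conformal_log h g z) * \<bar>gauss_curvature h g z\<bar>
        \<le> 2 * t / (1 - (norm z)\<^sup>2)\<^sup>2 + 2 * \<kappa>\<^sup>2 / (1 - (norm z)\<^sup>2) powr (2 * t)"
        by (meson add_increasing2 divide_nonneg_nonneg mult_nonneg_nonneg powr_ge_zero zero_le_numeral zero_le_power2)
    qed
  next
    fix t :: real
    assume t: "0 \<le> t" "t < 1"
    assume b: "\<forall>z\<in>ball 0 1.
             norm (schwarzian h g z -
                   of_real (2 * t * (1 - t)) * (cnj z)\<^sup>2 / of_real ((1 - (norm z)\<^sup>2)\<^sup>2))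
               + exp (2 * conformal_log h g z) * \<bar>gauss_curvature h g z\<bar>
             \<le> 2 * t / (1 - (norm z)\<^sup>2)\<^sup>2
               + 2 * pi / (1 - (norm z)\<^sup>2) powr (2 * t)
                 * (Gamma (3 / 2 - t) / Gamma (1 - t))\<^sup>2"
    obtain x y c w l where geo: "geodesic_arc t x y c w l" and ends: "{c x, c y} = {z1, z2}"
      using geodesic_arc_exists[OF t(1) z] by metis
    define \<delta> where "\<delta> = sqrt pi * Gamma (1 - t) / Gamma (3 / 2 - t)"
    have Gam: "Gamma (1 - t) > 0" "Gamma (3 / 2 - t) > 0"
      using t by (auto intro!: Gamma_real_pos)
    then have \<delta>: "\<delta> > 0" by (simp add: \<delta>_def)
    define \<kappa> where "\<kappa> = pi / \<delta>"
    have \<kappa>: "\<kappa> > 0" "\<kappa> * integral {x..y} l < pi"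
      using geodesic_arc_length[OF geo t, folded \<delta>_def] \<delta> by (auto simp: \<kappa>_def field_simps)
    have "2 * \<kappa>\<^sup>2 = 2 * pi * (Gamma (3 / 2 - t) / Gamma (1 - t))\<^sup>2"
    proof -
      have "pi / (sqrt pi * x) = sqrt pi / x" for x
        using real_div_sqrt[of pi] by (simp flip: divide_divide_eq_left)
      from this[of "Gamma (1 - t) / Gamma (3 / 2 - t)"]
      have "\<kappa> = sqrt pi * (Gamma (3 / 2 - t) / Gamma (1 - t))" by (simp add: \<kappa>_def \<delta>_def)
      then show ?thesis by (simp only: power_mult_distrib) simp
    qed
    then have \<kappa>2: "2 * \<kappa>\<^sup>2 / d = 2 * pi / d * (Gamma (3 / 2 - t) / Gamma (1 - t))\<^sup>2" for d
      by simp
    show False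
      by (rule double_point_on_short_geodesic_impossible[OF t(1) \<kappa>(1) _ geo \<kappa>(2) double[OF ends]])
         (unfold \<kappa>2, use b in blast)
  qed
qed

end
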